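(* Let $0<p\le1$ and $f\in H^p(\mathbb{C}_{+1})$. Then there exist a positive constant $A_p$, depending only on $p$, and a slowly increasing continuous function $F$ on $\mathbb{R}$ whose support is contained in $[0,\infty)$, such that for every $\varphi$ in the Schwartz class $\mathbb{S}$ on $\mathbb{R}$, $$(F,\varphi)=\lim_{y>0,\;y\to0}\int_{\mathbb{R}}f(x+iy)\hat{\varphi}(x)\,dx,$$ and such that $$|F(t)|\le A_p\|f\|_{H^p_{+1}}|t|^{\frac1p-1}\qquad(t\in\mathbb{R})$$ and $$f(z)=\frac{1}{\sqrt{2\pi}}\int_0^\infty F(t)e^{itz}\,dt\qquad(z\in\mathbb{C}_{+1}).$$
   Context: $\mathbb{C}_{+1}=\{z=x+iy: y>0\}$. For $0<p<\infty$, $H^p(\mathbb{C}_{+1})$ is the space of functions $f$ analytic in $\mathbb{C}_{+1}$ with $\|f\|_{H^p_{+1}}=\sup_{y>0}\left(\int_{-\infty}^{\infty}|f(x+iy)|^p\,dx\right)^{1/p}<\infty$. The Fourier transform is $\hat\varphi(x)=\frac{1}{\sqrt{2\pi}}\int_{\mathbb{R}}\varphi(t)e^{-ixt}\,dt$. A measurable function $F$ on $\mathbb{R}$ is slowly increasing if $F(x)/(1+x^2)^m\in L^\infty(\mathbb{R})$ for some positive integer $m$; it is regarded as a tempered distribution through $(F,\varphi)=\int_{\mathbb{R}}F(x)\varphi(x)\,dx$ for $\varphi\in\mathbb{S}$. When $p=1$, $|t|^{\frac1p-1}$ is read as $1$. *)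

theory Defs
  imports "HOL-Analysis.Analysis"
begin

definition upper_half_plane :: "complex set" where
  "upper_half_plane = {z. Im z > 0}"

definition ennreal_powr :: "ennreal \<Rightarrow> real \<Rightarrow> ennreal" where
  "ennreal_powr a r = (if a = \<infinity> then \<infinity> else ennreal (enn2real a powr r))"

(* The supremum is taken in [0, \<infinity>], so that a divergent integral or an unbounded family
   gives the value \<infinity>. *)
definition hardy_norm :: "real \<Rightarrow> (complex \<Rightarrow> complex) \<Rightarrow> ennreal" where
  "hardy_norm p f =
     (SUP y\<in>{0<..}. ennreal_powr (\<integral>\<^sup>+x. ennreal (cmod (f (Complex x y)) powr p) \<partial>lborel) (1 / p))"

definition hardy_space :: "real \<Rightarrow> (complex \<Rightarrow> complex) set" where
  "hardy_space p = {f. f holomorphic_on upper_half_plane \<and> hardy_norm p f < \<infinity>}"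

definition iter_deriv :: "nat \<Rightarrow> (real \<Rightarrow> complex) \<Rightarrow> real \<Rightarrow> complex" where
  "iter_deriv k = (\<lambda>g x. vector_derivative g (at x)) ^^ k"

definition schwartz :: "(real \<Rightarrow> complex) set" where
  "schwartz = {\<phi>.
     (\<forall>k x. iter_deriv k \<phi> differentiable (at x)) \<and>
     (\<forall>j k. bounded (range (\<lambda>x. of_real (x ^ j) * iter_deriv k \<phi> x)))}"

definition fourier :: "(real \<Rightarrow> complex) \<Rightarrow> real \<Rightarrow> complex" where
  "fourier \<phi> x = 1 / sqrt (2 * pi) * (LINT t|lborel. \<phi> t * exp (- \<i> * of_real x * of_real t))"

definition slowly_increasing :: "(real \<Rightarrow> complex) \<Rightarrow> bool" where
  "slowly_increasing F \<longleftrightarrow> F \<in> borel_measurable lebesgue \<and>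
     (\<exists>m::nat. m > 0 \<and> (\<exists>C. AE x in lebesgue. cmod (F x / of_real ((1 + x\<^sup>2) ^ m)) \<le> C))"

definition pairing :: "(real \<Rightarrow> complex) \<Rightarrow> (real \<Rightarrow> complex) \<Rightarrow> complex" where
  "pairing F \<phi> = (LINT x|lebesgue. F x * \<phi> x)"

(* The case p = 1 is separated because 0 powr 0 = 0, whereas the weight is 1 there. *)
definition hardy_weight :: "real \<Rightarrow> real \<Rightarrow> real" where
  "hardy_weight p t = (if p = 1 then 1 else \<bar>t\<bar> powr (1 / p - 1))"

end

theory Submission
  imports Defs "HOL-Complex_Analysis.Complex_Analysis"
begin

text \<open> A function in the Hardy space of exponent \<open>p \<le> 1\<close> is integrable on
every horizontal line of the upper half-plane, so its Fourier transform on such a line is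
available in the elementary sense, and \<open>F\<close> is this transform, suitably normalised.
The substance is a quantitative form of the first assertion: the \<open>L\<^sup>1\<close> norm
of \<open>f\<close> on the line at height \<open>y\<close> is at most a constant times \<open>y
powr (1 - 1 / p)\<close> times the Hardy norm (\<open>hardy_space_integrable_on_lines\<close>).
It holds because \<open>norm (f w) powr p\<close> satisfies a mean value inequality
(\<open>powr_norm_le_square_mean\<close>), which makes \<open>norm (f (x + \<i> y)) powr
p\<close> at most of order \<open>1 / y\<close>, and because \<open>norm (f w)\<close> is the
product of \<open>norm (f w) powr p\<close>, whose line integrals are controlled by the Hardy
norm, and \<open>norm (f w) powr (1 - p)\<close>, which the pointwise estimate controls.

Put \<open>F t = (1 / sqrt (2 * pi)) * \<integral> f (x + \<i> y) * exp (- \<i> * t * (x + \<i>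
y)) dx\<close>. By Cauchy's theorem in a strip this does not depend on \<open>y > 0\<close>
(\<open>line_integral_shift\<close>). Hence \<open>norm (F t)\<close> is at most a constant
times \<open>exp (t * y) * y powr (1 - 1 / p)\<close> for every \<open>y > 0\<close>; letting
\<open>y\<close> tend to infinity shows \<open>F t = 0\<close> for \<open>t < 0\<close>, and
\<open>y = 1 / t\<close> gives the bound \<open>t powr (1 / p - 1)\<close> for \<open>t >
0\<close>.

The two representation formulas are exchanges of integrals. In the Laplace integral of
\<open>F\<close> the inner integral over \<open>t\<close> is a Cauchy kernel, and the Cauchy
formula in a half-plane gives back \<open>f z\<close> (\<open>spectrum_inversion\<close>). In
the pairing with a Schwartz function the exchange moves the Fourier transform to
\<open>f\<close> and leaves \<open>\<integral> F t * \<phi> t * exp (- t * y) dt\<close>, which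
converges to the pairing as \<open>y\<close> tends to 0 by dominated convergence
(\<open>boundary_values_pairing\<close>). \<close>

section \<open>Cauchy's formula on rectangles\<close>

text \<open>The contour integral of \<open>g\<close> around the rectangle \<open>[a, b] \<times>
[c, d]\<close>, counterclockwise, written out as four Lebesgue integrals, so that its sides can
be estimated, averaged and sent to infinity one by one.\<close>
definition rect_integral :: "(complex \<Rightarrow> complex) \<Rightarrow> real \<Rightarrow> real \<Rightarrow> real \<Rightarrow> real \<Rightarrow> complex" where
  "rect_integral g a b c d =
     (LINT x:{a..b}|lborel. g (Complex x c)) + \<i> * (LINT y:{c..d}|lborel. g (Complex b y))
     - (LINT x:{a..b}|lborel. g (Complex x d)) - \<i> * (LINT y:{c..d}|lborel. g (Complex a y))"

text \<open>A vertical translation carries the horizontal segment to the real axis.\<close>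
lemma contour_integral_linepath_same_Im:
  assumes "a < b"
  shows "contour_integral (linepath (Complex a d) (Complex b d)) g
           = integral {a..b} (\<lambda>x. g (Complex x d))"
proof -
  have "contour_integral (linepath (Complex a d) (Complex b d)) g
      = contour_integral (linepath (of_real a) (of_real b)) (\<lambda>w. g (w + \<i> * of_real d))"
    unfolding contour_integral_integral vector_derivative_linepath_at
    by (simp add: linepath_def Complex_eq scaleR_conv_of_real algebra_simps)
  also have "\<dots> = integral {a..b} (\<lambda>x. g (Complex x d))"
    using assms by (subst contour_integral_linepath_Reals_eq) (auto simp: Complex_eq algebra_simps)
  finally show ?thesis .
qed

lemma contour_integral_rectpath:
  assumes "a < b" "c < d" and cont: "continuous_on (path_image (rectpath (Complex a c) (Complex b d))) g"
  shows "contour_integral (rectpath (Complex a c) (Complex b d)) g = rect_integral g a b c d"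
proof -
  let ?P = "path_image (rectpath (Complex a c) (Complex b d))"
  have P: "?P = {z. Re z \<in> {a, b} \<and> Im z \<in> {c..d}} \<union> {z. Im z \<in> {c, d} \<and> Re z \<in> {a..b}}"
    using assms by (subst path_image_rectpath) auto
  have seg: "closed_segment (Complex a c) (Complex b c) \<subseteq> ?P" "closed_segment (Complex b c) (Complex b d) \<subseteq> ?P"
    "closed_segment (Complex a d) (Complex b d) \<subseteq> ?P" "closed_segment (Complex a c) (Complex a d) \<subseteq> ?P"
    unfolding P using assms
    by (auto simp: closed_segment_same_Re closed_segment_same_Im closed_segment_eq_real_ivl)
  have seg': "closed_segment (Complex b d) (Complex a d) \<subseteq> ?P" "closed_segment (Complex a d) (Complex a c) \<subseteq> ?P"
    using seg by (simp_all add: closed_segment_commute)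
  have ci: "g contour_integrable_on linepath u v" if "closed_segment u v \<subseteq> ?P" for u v
    by (rule contour_integrable_continuous_linepath) (rule continuous_on_subset[OF cont that])
  have rev: "contour_integral (linepath u v) g = - contour_integral (linepath v u) g" if "closed_segment u v \<subseteq> ?P" for u v
    by (rule contour_integral_reverse_linepath) (rule continuous_on_subset[OF cont that])
  have h: "set_integrable lborel {a..b} (\<lambda>x. g (Complex x e))" if "e \<in> {c,d}" for e
    by (rule borel_integrable_atLeastAtMost', rule continuous_on_compose2[OF cont])
       (use that in \<open>auto simp: P intro!: continuous_intros\<close>)
  have v: "set_integrable lborel {c..d} (\<lambda>y. g (Complex e y))" if "e \<in> {a,b}" for e
    by (rule borel_integrable_atLeastAtMost', rule continuous_on_compose2[OF cont])
       (use that in \<open>auto simp: P intro!: continuous_intros\<close>)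
  have "contour_integral (rectpath (Complex a c) (Complex b d)) g =
     contour_integral (linepath (Complex a c) (Complex b c)) g + contour_integral (linepath (Complex b c) (Complex b d)) g
     + contour_integral (linepath (Complex b d) (Complex a d)) g + contour_integral (linepath (Complex a d) (Complex a c)) g"
    unfolding rectpath_def Let_def
    by (simp add: contour_integrable_joinI ci seg seg' add.assoc)
  also have "\<dots> = contour_integral (linepath (Complex a c) (Complex b c)) g + contour_integral (linepath (Complex b c) (Complex b d)) g
     - contour_integral (linepath (Complex a d) (Complex b d)) g - contour_integral (linepath (Complex a c) (Complex a d)) g"
    using rev[OF seg'(1)] rev[OF seg'(2)] by simp
  also have "\<dots> = rect_integral g a b c d"
    unfolding rect_integral_def
    using assms h v
    by (simp add: contour_integral_linepath_same_Im contour_integral_linepath_same_Re set_borel_integral_eq_integral(2))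
  finally show ?thesis .
qed

lemma rect_integral_eq_0:
  assumes "a < b" "c < d" and g: "g holomorphic_on S" and S: "open S" "convex S" "cbox (Complex a c) (Complex b d) \<subseteq> S"
  shows "rect_integral g a b c d = 0"
proof -
  have sub: "path_image (rectpath (Complex a c) (Complex b d)) \<subseteq> S"
    using path_image_rectpath_subset_cbox[of "Complex a c" "Complex b d"] assms by auto
  have "(g has_contour_integral 0) (rectpath (Complex a c) (Complex b d))"
    by (rule Cauchy_theorem_convex_simple[OF g S(2)]) (use sub in auto)
  then show ?thesis
    using contour_integral_rectpath[OF assms(1,2), of g] contour_integral_unique
      continuous_on_subset[OF holomorphic_on_imp_continuous_on[OF g] sub] by metis
qed

lemma rect_integral_Cauchy_formula:
  assumes "z \<in> box (Complex a c) (Complex b d)" and g: "g holomorphic_on S"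
    and S: "open S" "convex S" "cbox (Complex a c) (Complex b d) \<subseteq> S"
  shows "rect_integral (\<lambda>w. g w / (w - z)) a b c d = 2 * pi * \<i> * g z"
proof -
  have ab: "a < b" "c < d" using assms(1) by (auto simp: in_box_complex_iff)
  have sub: "path_image (rectpath (Complex a c) (Complex b d)) \<subseteq> S - {z}"
    using path_image_rectpath_cbox_minus_box[of "Complex a c" "Complex b d"] assms ab by auto
  have zS: "z \<in> interior S" using assms(1) S box_subset_cbox interior_open by blast
  have "((\<lambda>w. g w / (w-z)) has_contour_integral
       (2*pi * \<i> * winding_number (rectpath (Complex a c) (Complex b d)) z * g z)) (rectpath (Complex a c) (Complex b d))"
    by (rule Cauchy_integral_formula_convex_simple[OF S(2) g zS]) (use sub in auto)
  moreover have "winding_number (rectpath (Complex a c) (Complex b d)) z = 1"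
    by (rule winding_number_rectpath) (rule assms)
  moreover have "continuous_on (path_image (rectpath (Complex a c) (Complex b d))) (\<lambda>w. g w / (w-z))"
    using sub by (intro continuous_intros continuous_on_subset[OF holomorphic_on_imp_continuous_on[OF g]]) auto
  ultimately show ?thesis
    using contour_integral_rectpath[OF ab] contour_integral_unique by (metis mult.right_neutral)
qed

section \<open>Mean value inequalities over squares\<close>

lemma ennreal_norm_integral_le: 
  fixes g :: "'a \<Rightarrow> 'b::{banach, second_countable_topology}"
  shows "ennreal (norm (LINT x|M. g x)) \<le> (\<integral>\<^sup>+x. ennreal (norm (g x)) \<partial>M)"
  by (cases "integrable M g") (auto intro: integral_norm_bound_ennreal simp: not_integrable_integral_eq)

definition csquare :: "complex \<Rightarrow> real \<Rightarrow> complex set" where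
  "csquare z r = cbox (Complex (Re z - r) (Im z - r)) (Complex (Re z + r) (Im z + r))"

text \<open>The planar Lebesgue integral as an iterated one: everything below slices the plane
by horizontal and vertical lines.\<close>
definition area_integral :: "(complex \<Rightarrow> ennreal) \<Rightarrow> ennreal" where
  "area_integral h = (\<integral>\<^sup>+y. \<integral>\<^sup>+x. h (Complex x y) \<partial>lborel \<partial>lborel)"

lemma Complex_measurable [measurable (raw)]:
  assumes "f \<in> borel_measurable M" "g \<in> borel_measurable M"
  shows "(\<lambda>x. Complex (f x) (g x)) \<in> borel_measurable M"
  unfolding Complex_eq using assms by measurable

lemma area_integral_mono: "(\<And>w. g w \<le> h w) \<Longrightarrow> area_integral g \<le> area_integral h"
  unfolding area_integral_def by (intro nn_integral_mono)

lemma area_integral_cmult: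
  assumes [measurable]: "h \<in> borel_measurable borel"
  shows "area_integral (\<lambda>w. c * h w) = c * area_integral h"
  unfolding area_integral_def by (simp add: nn_integral_cmult)

lemma csquare_iff: "w \<in> csquare z r \<longleftrightarrow> \<bar>Re w - Re z\<bar> \<le> r \<and> \<bar>Im w - Im z\<bar> \<le> r"
  by (auto simp: csquare_def in_cbox_complex_iff)

text \<open>The two points at distance \<open>s\<close> from \<open>c\<close> sweep out the line
as \<open>s\<close> varies. With \<open>H\<close> the integral along a horizontal or vertical
line, this turns the average over concentric squares of the integrals along two opposite sides
into an area integral.\<close>
lemma nn_integral_reflect_le:
  fixes H :: "real \<Rightarrow> ennreal"
  assumes [measurable]: "H \<in> borel_measurable borel"
  shows "(\<integral>\<^sup>+s. (H (c - s) + H (c + s)) * indicator {0<..} s \<partial>lborel) \<le> (\<integral>\<^sup>+y. H y \<partial>lborel)"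
proof -
  have "(\<integral>\<^sup>+y. H y * indicator {..<c} y \<partial>lborel) = (\<integral>\<^sup>+s. H (c - s) * indicator {0<..} s \<partial>lborel)"
    by (subst nn_integral_real_affine[where c = "-1" and t = c]) (auto simp: indicator_def)
  moreover have "(\<integral>\<^sup>+y. H y * indicator {c<..} y \<partial>lborel) = (\<integral>\<^sup>+s. H (c + s) * indicator {0<..} s \<partial>lborel)"
    by (subst nn_integral_real_affine[where c = "1" and t = c]) (auto simp: indicator_def)
  ultimately have "(\<integral>\<^sup>+s. (H (c - s) + H (c + s)) * indicator {0<..} s \<partial>lborel)
     = (\<integral>\<^sup>+y. H y * indicator {..<c} y + H y * indicator {c<..} y \<partial>lborel)"
    by (simp add: distrib_right nn_integral_add)
  also have "\<dots> \<le> (\<integral>\<^sup>+y. H y \<partial>lborel)"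
    by (intro nn_integral_mono) (auto simp: indicator_def)
  finally show ?thesis .
qed

lemma norm_rect_sum_le:
  "norm (A + \<i> * D - B - \<i> * C) \<le> norm A + norm B + (norm C + norm D)"
proof -
  have "norm (A + \<i> * D - B - \<i> * C) \<le> norm (A + \<i> * D - B) + norm (\<i> * C)"
    by (rule norm_triangle_ineq4)
  also have "norm (A + \<i> * D - B) \<le> norm (A + \<i> * D) + norm B" by (rule norm_triangle_ineq4)
  also have "norm (A + \<i> * D) \<le> norm A + norm (\<i> * D)" by (rule norm_triangle_ineq)
  finally show ?thesis by (simp add: norm_mult)
qed

text \<open>The Cauchy formula on the boundary of a square, whose points have distance at least
\<open>s\<close> from the centre \<open>z\<close>, bounds \<open>2 * pi * s * norm (f z)\<close>
by the integral of \<open>norm (f w)\<close> along the four sides. The side integrals are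
extended to full lines by means of a function \<open>N\<close> that agrees with \<open>norm (f
w)\<close> on the square and is arbitrary elsewhere, so that they fit into the slices of an area
integral.\<close>
lemma norm_le_square_sides:
  assumes f: "f holomorphic_on S" and S: "open S" "convex S" "csquare z s \<subseteq> S" and s: "s > 0"
    and N: "\<And>w. w \<in> csquare z s \<Longrightarrow> N w = ennreal (norm (f w))"
  shows "ennreal (2 * pi * s * norm (f z)) \<le>
     (\<integral>\<^sup>+x. N (Complex x (Im z - s)) \<partial>lborel) + (\<integral>\<^sup>+x. N (Complex x (Im z + s)) \<partial>lborel)
   + ((\<integral>\<^sup>+y. N (Complex (Re z - s) y) \<partial>lborel) + (\<integral>\<^sup>+y. N (Complex (Re z + s) y) \<partial>lborel))"
proof -
  define a b where "a = Re z" and "b = Im z"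
  have z: "z = Complex a b" by (simp add: a_def b_def)
  have side: "ennreal (s * norm (LINT t:{u..v}|lborel. f (\<gamma> t) / (\<gamma> t - z))) \<le> (\<integral>\<^sup>+t. N (\<gamma> t) \<partial>lborel)"
    if "\<And>t. t \<in> {u..v} \<Longrightarrow> \<gamma> t \<in> csquare z s \<and> s \<le> norm (\<gamma> t - z)" for u v \<gamma>
  proof -
    have "ennreal (s * norm (LINT t:{u..v}|lborel. f (\<gamma> t) / (\<gamma> t - z)))
        = ennreal (norm (LINT t:{u..v}|lborel. s *\<^sub>R (f (\<gamma> t) / (\<gamma> t - z))))"
      using s by (subst set_integral_scaleR_right) (simp add: norm_mult)
    also have "\<dots> \<le> (\<integral>\<^sup>+t. ennreal (norm (indicator {u..v} t *\<^sub>R s *\<^sub>R (f (\<gamma> t) / (\<gamma> t - z)))) \<partial>lborel)"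
      unfolding set_lebesgue_integral_def by (rule ennreal_norm_integral_le)
    also have "\<dots> \<le> (\<integral>\<^sup>+t. N (\<gamma> t) \<partial>lborel)"
    proof (intro nn_integral_mono)
      fix t
      show "ennreal (norm (indicator {u..v} t *\<^sub>R s *\<^sub>R (f (\<gamma> t) / (\<gamma> t - z)))) \<le> N (\<gamma> t)"
      proof (cases "t \<in> {u..v}")
        case True
        then have "s \<le> norm (\<gamma> t - z)" "N (\<gamma> t) = ennreal (norm (f (\<gamma> t)))" using that N by auto
        moreover have "s * norm (f (\<gamma> t)) / norm (\<gamma> t - z) \<le> norm (f (\<gamma> t))"
          using calculation s mult_right_mono[of s "norm (\<gamma> t - z)" "norm (f (\<gamma> t))"]
          by (subst pos_divide_le_eq) (auto simp: mult.commute)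
        ultimately show ?thesis using True s by (auto simp: norm_mult norm_divide intro!: ennreal_leI)
      qed auto
    qed
    finally show ?thesis .
  qed
  let ?g = "\<lambda>w. f w / (w - z)"
  have "2 * pi * norm (f z) = norm (rect_integral ?g (a - s) (a + s) (b - s) (b + s))"
    using S s f by (subst rect_integral_Cauchy_formula[OF _ f])
      (auto simp: csquare_def norm_mult a_def b_def in_box_complex_iff)
  also have "\<dots> \<le> norm (LINT x:{a - s..a + s}|lborel. ?g (Complex x (b - s))) + norm (LINT x:{a - s..a + s}|lborel. ?g (Complex x (b + s)))
      + (norm (LINT y:{b - s..b + s}|lborel. ?g (Complex (a - s) y)) + norm (LINT y:{b - s..b + s}|lborel. ?g (Complex (a + s) y)))"
    (is "_ \<le> ?A + ?B + (?C + ?D)")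
    unfolding rect_integral_def by (rule norm_rect_sum_le)
  finally have "s * (2 * pi * norm (f z)) \<le> s * (?A + ?B + (?C + ?D))"
    using s by (intro mult_left_mono) auto
  then have "ennreal (2 * pi * s * norm (f z)) \<le> ennreal (s * ?A + s * ?B + (s * ?C + s * ?D))"
    by (intro ennreal_leI) (simp only: distrib_left mult_ac)
  also have "\<dots> = ennreal (s * ?A) + ennreal (s * ?B) + (ennreal (s * ?C) + ennreal (s * ?D))"
    using s by (simp add: ennreal_plus)
  also have "\<dots> \<le>  (\<integral>\<^sup>+x. N (Complex x (Im z - s)) \<partial>lborel) + (\<integral>\<^sup>+x. N (Complex x (Im z + s)) \<partial>lborel)
   + ((\<integral>\<^sup>+y. N (Complex (Re z - s) y) \<partial>lborel) + (\<integral>\<^sup>+y. N (Complex (Re z + s) y) \<partial>lborel))"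
    unfolding a_def b_def
  proof (intro add_mono side)
    have nrm: "\<bar>x - Re z\<bar> \<le> norm (Complex x y - z)" "\<bar>y - Im z\<bar> \<le> norm (Complex x y - z)" for x y
      using abs_Re_le_cmod[of "Complex x y - z"] abs_Im_le_cmod[of "Complex x y - z"] by auto
    show "Complex x (Im z - s) \<in> csquare z s \<and> s \<le> norm (Complex x (Im z - s) - z)"
         "Complex x (Im z + s) \<in> csquare z s \<and> s \<le> norm (Complex x (Im z + s) - z)" if "x \<in> {Re z - s..Re z + s}" for x
      using that s nrm(2)[of "Im z - s" x] nrm(2)[of "Im z + s" x] by (auto simp: csquare_iff)
    show "Complex (Re z - s) y \<in> csquare z s \<and> s \<le> norm (Complex (Re z - s) y - z)"
         "Complex (Re z + s) y \<in> csquare z s \<and> s \<le> norm (Complex (Re z + s) y - z)" if "y \<in> {Im z - s..Im z + s}" for y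
      using that s nrm(1)[of "Re z - s" y] nrm(1)[of "Re z + s" y] by (auto simp: csquare_iff)
  qed
  finally show ?thesis .
qed

lemma csquare_mono: "s \<le> r \<Longrightarrow> csquare z s \<subseteq> csquare z r"
  by (auto simp: csquare_iff)

lemma borel_measurable_indicator_csquare:
  fixes g :: "complex \<Rightarrow> real"
  assumes "continuous_on (csquare z r) g"
  shows "(\<lambda>w. ennreal (g w) * indicator (csquare z r) w) \<in> borel_measurable borel"
proof -
  have "(\<lambda>w. indicator (csquare z r) w *\<^sub>R g w) \<in> borel_measurable borel"
    by (rule borel_measurable_continuous_on_indicator) (use assms in \<open>auto simp: csquare_def\<close>)
  then have "(\<lambda>w. ennreal (indicator (csquare z r) w *\<^sub>R g w)) \<in> borel_measurable borel"
    by measurable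
  also have "(\<lambda>w. ennreal (indicator (csquare z r) w *\<^sub>R g w)) = (\<lambda>w. ennreal (g w) * indicator (csquare z r) w)"
    by (auto simp: indicator_def)
  finally show ?thesis .
qed

text \<open>Averaging the previous bound over the squares of half-side \<open>s \<in> [r / 2,
r]\<close>: each pair of opposite sides covers part of the large square once, so the right-hand
sides add up to at most twice the area integral. Squares instead of discs avoid polar
coordinates; only the existence of some constant matters, and \<open>pi > 2\<close> allows the
convenient value 2.\<close>
lemma norm_le_square_mean:
  assumes f: "f holomorphic_on S" and S: "open S" "convex S" "csquare z r \<subseteq> S" and r: "r > 0"
  shows "ennreal (r\<^sup>2 * norm (f z)) \<le> 2 * area_integral (\<lambda>w. ennreal (norm (f w)) * indicator (csquare z r) w)"
proof -
  define N where "N = (\<lambda>w. ennreal (norm (f w)) * indicator (csquare z r) w)"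
  have [measurable]: "N \<in> borel_measurable borel"
    unfolding N_def using S
    by (intro borel_measurable_indicator_csquare continuous_intros
          continuous_on_subset[OF holomorphic_on_imp_continuous_on[OF f]]) 
  define H V where "H = (\<lambda>y. \<integral>\<^sup>+x. N (Complex x y) \<partial>lborel)" and "V = (\<lambda>x. \<integral>\<^sup>+y. N (Complex x y) \<partial>lborel)"
  have [measurable]: "H \<in> borel_measurable borel" "V \<in> borel_measurable borel"
    unfolding H_def V_def by measurable
  have VH: "(\<integral>\<^sup>+x. V x \<partial>lborel) = (\<integral>\<^sup>+y. H y \<partial>lborel)"
    unfolding V_def H_def by (intro lborel_pair.Fubini') measurable
  have "ennreal (pi * r\<^sup>2 / 2 * norm (f z)) = (\<integral>\<^sup>+s. ennreal (pi * r * norm (f z)) * indicator {r/2..r} s \<partial>lborel)"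
    using r by (simp add: nn_integral_cmult_indicator ennreal_mult[symmetric] power2_eq_square mult_ac)
  also have "\<dots> \<le> (\<integral>\<^sup>+s. (H (Im z - s) + H (Im z + s)) * indicator {0<..} s + (V (Re z - s) + V (Re z + s)) * indicator {0<..} s \<partial>lborel)"
  proof (intro nn_integral_mono)
    fix s
    show "ennreal (pi * r * norm (f z)) * indicator {r/2..r} s
        \<le> (H (Im z - s) + H (Im z + s)) * indicator {0<..} s + (V (Re z - s) + V (Re z + s)) * indicator {0<..} s"
    proof (cases "s \<in> {r/2..r}")
      case True
      then have s: "s > 0" "s \<le> r" "r \<le> 2 * s" using r by auto
      have "ennreal (pi * r * norm (f z)) \<le> ennreal (2 * pi * s * norm (f z))"
        using s by (intro ennreal_leI mult_right_mono) auto
      also have "\<dots> \<le> H (Im z - s) + H (Im z + s) + (V (Re z - s) + V (Re z + s))"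
        unfolding H_def V_def
        by (rule norm_le_square_sides[OF f S(1,2) _ s(1)]) (use csquare_mono[OF s(2), of z] S(3) in \<open>auto simp: N_def\<close>)
      finally show ?thesis using s True by simp
    qed auto
  qed
  also have "\<dots> \<le> (\<integral>\<^sup>+y. H y \<partial>lborel) + (\<integral>\<^sup>+x. V x \<partial>lborel)"
    by (subst nn_integral_add) (auto intro!: add_mono nn_integral_reflect_le)
  also have "\<dots> = 2 * area_integral N"
    unfolding VH by (simp add: area_integral_def H_def mult_2)
  finally have *: "ennreal (pi * r\<^sup>2 / 2 * norm (f z)) \<le> 2 * area_integral N" .
  have "2 * (r\<^sup>2 * norm (f z)) \<le> pi * (r\<^sup>2 * norm (f z))"
    using pi_gt3 by (intro mult_right_mono) auto
  then have "ennreal (r\<^sup>2 * norm (f z)) \<le> ennreal (pi * r\<^sup>2 / 2 * norm (f z))"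
    by (intro ennreal_leI) (simp add: field_simps)
  also note *
  finally show ?thesis unfolding N_def .
qed

lemma powr_split: "0 \<le> x \<Longrightarrow> x powr p * x powr (1 - p) = (x::real)"
  by (cases "x = 0") (auto simp: powr_add[symmetric])

text \<open>For \<open>p < 1\<close> the mean value inequality for \<open>norm (f w) powr
p\<close> is usually read off from subharmonicity. A maximum argument gets it from the case
\<open>p = 1\<close> alone. Let \<open>d w\<close> be the distance from \<open>w\<close> to the
boundary of the square and let \<open>z0\<close> maximise \<open>(d w)\<^sup>2 * norm (f w) powr
p\<close>. On the square about \<open>z0\<close> of half-side \<open>s = d z0 / 2\<close> the
weight has dropped by a factor of at most 4, hence \<open>norm (f w) powr p \<le> 4 * norm (f
z0) powr p\<close> there. Writing \<open>norm (f w)\<close> as the product of its powers with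
exponents \<open>p\<close> and \<open>1 - p\<close>, the mean value inequality at
\<open>z0\<close> therefore involves only the integral of \<open>norm (f w) powr p\<close>, and
it bounds the maximum, which in turn dominates the value \<open>r\<^sup>2 * norm (f z) powr
p\<close> at the centre.\<close>
lemma powr_norm_le_square_mean:
  assumes f: "f holomorphic_on S" and S: "open S" "convex S" "csquare z r \<subseteq> S" and r: "r > 0"
    and p: "0 < p" "p \<le> 1"
  shows "ennreal (r\<^sup>2 * norm (f z) powr p)
    \<le> ennreal (8 * 4 powr (1 / p - 1)) * area_integral (\<lambda>w. ennreal (norm (f w) powr p) * indicator (csquare z r) w)"
proof -
  define d where "d = (\<lambda>w. r - max \<bar>Re w - Re z\<bar> \<bar>Im w - Im z\<bar>)"
  define g where "g = (\<lambda>w. (d w)\<^sup>2 * norm (f w) powr p)"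
  let ?I = "area_integral (\<lambda>w. ennreal (norm (f w) powr p) * indicator (csquare z r) w)"
  have cf: "continuous_on (csquare z r) f"
    using S by (intro continuous_on_subset[OF holomorphic_on_imp_continuous_on[OF f]])
  have cfp: "continuous_on (csquare z r) (\<lambda>w. norm (f w) powr p)"
    using p by (intro continuous_on_powr' continuous_intros cf) auto
  have "continuous_on (csquare z r) g"
    unfolding g_def d_def by (intro continuous_intros cfp)
  moreover have "compact (csquare z r)" "z \<in> csquare z r" using r by (auto simp: csquare_def in_cbox_complex_iff)
  ultimately obtain z0 where z0: "z0 \<in> csquare z r" and max: "\<And>w. w \<in> csquare z r \<Longrightarrow> g w \<le> g z0"
    using continuous_attains_sup[of "csquare z r" g] by auto
  have gz: "r\<^sup>2 * norm (f z) powr p \<le> g z0"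
    using max[OF \<open>z \<in> csquare z r\<close>] by (simp add: g_def d_def)
  show ?thesis
  proof (cases "g z0 = 0")
    case True
    then show ?thesis using gz by (simp add: ennreal_neg)
  next
    case False
    define B s where "B = norm (f z0)" and "s = d z0 / 2"
    have "d z0 \<ge> 0" using z0 by (auto simp: d_def csquare_iff)
    with False have s: "s > 0" and B: "B > 0" by (auto simp: g_def s_def B_def)
    have "max \<bar>Re z0 - Re z\<bar> \<bar>Im z0 - Im z\<bar> = r - 2 * s" by (simp add: s_def d_def field_simps)
    then have z0s: "\<bar>Re z0 - Re z\<bar> \<le> r - 2 * s" "\<bar>Im z0 - Im z\<bar> \<le> r - 2 * s" by linarith+
    have sub: "csquare z0 s \<subseteq> csquare z r" and half: "\<And>w. w \<in> csquare z0 s \<Longrightarrow> s \<le> d w"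
    proof -
      have *: "\<bar>Re w - Re z\<bar> \<le> r - s \<and> \<bar>Im w - Im z\<bar> \<le> r - s" if "w \<in> csquare z0 s" for w
        using that z0s unfolding csquare_iff by linarith
      show "csquare z0 s \<subseteq> csquare z r"
      proof
        fix w assume "w \<in> csquare z0 s"
        then show "w \<in> csquare z r" using *[of w] s unfolding csquare_iff by linarith
      qed
      show "s \<le> d w" if "w \<in> csquare z0 s" for w
        using *[OF that] by (auto simp: d_def max_def)
    qed
    \<comment> \<open>maximality of \<open>z0\<close> makes \<open>norm (f w)\<close> comparable to \<open>B\<close> near \<open>z0\<close>\<close>
    have fw: "norm (f w) \<le> 4 powr (1/p - 1) * B powr (1 - p) * norm (f w) powr p" if w: "w \<in> csquare z0 s" for w
    proof -
      have "s\<^sup>2 * norm (f w) powr p \<le> g w"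
        unfolding g_def using half[OF w] s by (intro mult_right_mono power_mono) auto
      also have "\<dots> \<le> s\<^sup>2 * (4 * B powr p)"
        using max[of w] w sub by (auto simp: g_def s_def B_def power2_eq_square)
      finally have "norm (f w) powr p \<le> 4 * B powr p" using s by simp
      then have "(norm (f w) powr p) powr (1/p - 1) \<le> (4 * B powr p) powr (1/p - 1)"
        using p by (intro powr_mono2) auto
      moreover have "p * (1/p - 1) = 1 - p" using p by (simp add: field_simps)
      ultimately have "norm (f w) powr (1 - p) \<le> 4 powr (1/p - 1) * B powr (1 - p)"
        by (simp add: powr_powr powr_mult)
      then have "norm (f w) powr p * norm (f w) powr (1 - p) \<le> norm (f w) powr p * (4 powr (1/p - 1) * B powr (1 - p))"
        by (intro mult_left_mono) auto
      then show ?thesis by (simp add: powr_split mult_ac)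
    qed
    let ?c = "4 powr (1/p - 1) * B powr (1 - p)"
    have "ennreal (s\<^sup>2 * B) \<le> 2 * area_integral (\<lambda>w. ennreal (norm (f w)) * indicator (csquare z0 s) w)"
      unfolding B_def using sub S by (intro norm_le_square_mean[OF f S(1,2) _ s]) auto
    also have "\<dots> \<le> 2 * area_integral (\<lambda>w. ennreal ?c * (ennreal (norm (f w) powr p) * indicator (csquare z r) w))"
    proof (intro mult_left_mono area_integral_mono)
      fix w
      show "ennreal (norm (f w)) * indicator (csquare z0 s) w \<le> ennreal ?c * (ennreal (norm (f w) powr p) * indicator (csquare z r) w)"
        using fw[of w] sub by (auto simp: indicator_def ennreal_mult[symmetric] intro!: ennreal_leI)
    qed auto
    also have "\<dots> = 2 * (ennreal ?c * ?I)"
      by (subst area_integral_cmult) (auto intro: borel_measurable_indicator_csquare cfp)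
    \<comment> \<open>this factor turns \<open>s\<^sup>2 * B\<close> back into the maximum \<open>(2 * s)\<^sup>2 * B powr p\<close>\<close>
    finally have "ennreal (4 * B powr (p - 1)) * ennreal (s\<^sup>2 * B) \<le> ennreal (4 * B powr (p - 1)) * (2 * (ennreal ?c * ?I))"
      by (intro mult_left_mono) auto
    also have "\<dots> = ennreal (4 * B powr (p - 1)) * (ennreal 2 * ennreal ?c) * ?I" by (simp add: mult_ac)
    also have "ennreal (4 * B powr (p - 1)) * (ennreal 2 * ennreal ?c) = ennreal (8 * 4 powr (1/p - 1))"
      using B by (subst ennreal_mult[symmetric]) (auto simp: ennreal_mult[symmetric] powr_add[symmetric])
    also have "ennreal (4 * B powr (p - 1)) * ennreal (s\<^sup>2 * B) = ennreal (g z0)"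
      using B by (subst ennreal_mult[symmetric]) (auto simp: g_def s_def B_def[symmetric] power2_eq_square powr_mult_base[symmetric] powr_diff field_simps)
    finally show ?thesis using gz by (meson ennreal_leI order.trans)
  qed
qed

section \<open>Functions integrable on horizontal lines\<close>

lemma open_upper_half_plane: "open upper_half_plane"
  unfolding upper_half_plane_def by (rule open_halfspace_Im_gt)

lemma convex_upper_half_plane: "convex upper_half_plane"
  unfolding upper_half_plane_def by (rule convex_halfspace_Im_gt)

lemma continuous_on_horizontal_line:
  assumes "f holomorphic_on upper_half_plane" "y > 0"
  shows "continuous_on UNIV (\<lambda>x. f (Complex x y))"
  by (rule continuous_on_compose2[OF holomorphic_on_imp_continuous_on[OF assms(1)]])
     (use assms(2) in \<open>auto intro!: continuous_intros simp: upper_half_plane_def\<close>)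

lemma measurable_horizontal_line:
  assumes "f holomorphic_on upper_half_plane" "y > 0"
  shows "(\<lambda>x. f (Complex x y)) \<in> borel_measurable borel"
  using continuous_on_horizontal_line[OF assms] by (rule borel_measurable_continuous_onI)

lemma tendsto_integral_symmetric_interval:
  fixes g :: "real \<Rightarrow> 'a::{banach, second_countable_topology}"
  assumes g: "integrable lborel g"
  shows "((\<lambda>R. LINT x:{-R..R}|lborel. g x) \<longlongrightarrow> (LINT x|lborel. g x)) at_top"
  unfolding set_lebesgue_integral_def
proof (rule integral_dominated_convergence_at_top[where w = "\<lambda>x. norm (g x)"])
  show "g \<in> borel_measurable lborel" using g by auto
  show "(\<lambda>x. indicator {-R..R} x *\<^sub>R g x) \<in> borel_measurable lborel" for R :: real using g by auto
  show "integrable lborel (\<lambda>x. norm (g x))" using g by auto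
  show "\<forall>\<^sub>F R in at_top. AE x in lborel. norm (indicator {-R..R} x *\<^sub>R g x) \<le> norm (g x)"
    by (auto simp: indicator_def)
  show "AE x in lborel. ((\<lambda>R. indicator {-R..R} x *\<^sub>R g x) \<longlongrightarrow> g x) at_top"
  proof (intro AE_I2 tendsto_eventually)
    fix x
    show "\<forall>\<^sub>F R in at_top. indicator {-R..R} x *\<^sub>R g x = g x"
      using eventually_ge_at_top[of "\<bar>x\<bar>"] by eventually_elim (auto simp: indicator_def)
  qed
qed

text \<open>What the spectral analysis needs to know about a Hardy function: it is integrable on
every horizontal line, with an \<open>L\<^sup>1\<close> norm growing at most like a power as the
line approaches the real axis. The exponent \<open>\<alpha>\<close> is \<open>1 / p - 1\<close>
for a function in the Hardy space of exponent \<open>p\<close>.\<close>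
locale integrable_on_lines =
  fixes f :: "complex \<Rightarrow> complex" and C \<alpha> :: real
  assumes hol: "f holomorphic_on upper_half_plane"
    and C_nonneg: "0 \<le> C" and \<alpha>_nonneg: "0 \<le> \<alpha>"
    and line_bound: "\<And>y. 0 < y \<Longrightarrow> (\<integral>\<^sup>+x. ennreal (norm (f (Complex x y))) \<partial>lborel) \<le> ennreal (C * y powr - \<alpha>)"
begin

lemma integrable_line: "0 < y \<Longrightarrow> integrable lborel (\<lambda>x. f (Complex x y))"
  using line_bound[of y] measurable_horizontal_line[OF hol, of y]
  by (intro integrableI_bounded) (auto intro: le_less_trans)

lemma integral_norm_line_le: "0 < y \<Longrightarrow> (LINT x|lborel. norm (f (Complex x y))) \<le> C * y powr - \<alpha>"
  using line_bound[of y] integrable_norm[OF integrable_line[of y]] C_nonneg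
  by (simp add: nn_integral_eq_integral ennreal_le_iff)

lemma integrable_line_mult:
  assumes "0 < y" and h: "h \<in> borel_measurable borel" and b: "\<And>x. norm (h x) \<le> B"
  shows "integrable lborel (\<lambda>x. f (Complex x y) * h x)"
    and "norm (LINT x|lborel. f (Complex x y) * h x) \<le> B * (C * y powr - \<alpha>)"
proof -
  have le: "norm (f (Complex x y) * h x) \<le> B * norm (f (Complex x y))" for x
    using b[of x] by (simp add: norm_mult mult.commute mult_right_mono)
  have B: "0 \<le> B" using b[of 0] norm_ge_zero order.trans by blast
  have int: "integrable lborel (\<lambda>x. B * norm (f (Complex x y)))"
    using integrable_line[OF assms(1)] by auto
  show *: "integrable lborel (\<lambda>x. f (Complex x y) * h x)"
    by (rule Bochner_Integration.integrable_bound[OF int])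
       (use le B h measurable_horizontal_line[OF hol assms(1)] in \<open>auto simp: abs_mult\<close>)
  have "norm (LINT x|lborel. f (Complex x y) * h x) \<le> (LINT x|lborel. B * norm (f (Complex x y)))"
    by (rule order.trans[OF integral_norm_bound integral_mono]) (use * int le in auto)
  also have "\<dots> \<le> B * (C * y powr - \<alpha>)"
    using integral_norm_line_le[OF assms(1)] B by (simp add: mult_left_mono)
  finally show "norm (LINT x|lborel. f (Complex x y) * h x) \<le> B * (C * y powr - \<alpha>)" .
qed

text \<open>By Tonelli, \<open>f\<close> is integrable over the strip \<open>a \<le> Im w \<le>
b\<close>. Hence the integrals over vertical cross-sections cannot stay above
\<open>\<epsilon>\<close> as the cross-sections move away. This replaces pointwise decay of
\<open>f\<close> at the ends of the strip when contours are closed at infinity.\<close>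
lemma exists_small_vertical_sides:
  assumes ab: "0 < a" "a < b" and "\<epsilon> > 0"
  shows "\<exists>R\<ge>R\<^sub>0. (\<integral>\<^sup>+y. ennreal (norm (f (Complex R y))) * indicator {a..b} y \<partial>lborel)
              + (\<integral>\<^sup>+y. ennreal (norm (f (Complex (-R) y))) * indicator {a..b} y \<partial>lborel) < ennreal \<epsilon>"
proof (rule ccontr)
  define S where "S = {w. Im w \<in> {a..b}}"
  define N where "N = (\<lambda>w. ennreal (norm (indicator S w *\<^sub>R f w)))"
  have "S = {w. Im w \<ge> a} \<inter> {w. Im w \<le> b}" by (auto simp: S_def)
  then have "closed S" by (simp add: closed_halfspace_Im_ge closed_halfspace_Im_le closed_Int)
  then have [measurable]: "(\<lambda>w. indicator S w *\<^sub>R f w) \<in> borel_measurable borel"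
    using ab by (intro borel_measurable_continuous_on_indicator
       continuous_on_subset[OF holomorphic_on_imp_continuous_on[OF hol]]) (auto simp: S_def upper_half_plane_def)
  have [measurable]: "N \<in> borel_measurable borel" unfolding N_def by measurable
  define G where "G = (\<lambda>x. \<integral>\<^sup>+y. N (Complex x y) \<partial>lborel)"
  have [measurable]: "G \<in> borel_measurable borel" unfolding G_def by measurable
  have G: "G x = (\<integral>\<^sup>+y. ennreal (norm (f (Complex x y))) * indicator {a..b} y \<partial>lborel)" for x
    unfolding G_def N_def S_def by (intro nn_integral_cong) (auto simp: indicator_def)
  assume "\<not> ?thesis"
  then have large: "ennreal \<epsilon> \<le> G R + G (-R)" if "R \<ge> R\<^sub>0" for R
    using that by (auto simp: G not_less)
  have "(\<integral>\<^sup>+x. G x \<partial>lborel) = (\<integral>\<^sup>+y. \<integral>\<^sup>+x. N (Complex x y) \<partial>lborel \<partial>lborel)"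
    unfolding G_def by (intro lborel_pair.Fubini') measurable
  also have "\<dots> \<le> (\<integral>\<^sup>+y. ennreal (C * a powr - \<alpha>) * indicator {a..b} y \<partial>lborel)"
  proof (intro nn_integral_mono)
    fix y
    show "(\<integral>\<^sup>+x. N (Complex x y) \<partial>lborel) \<le> ennreal (C * a powr - \<alpha>) * indicator {a..b} y"
    proof (cases "y \<in> {a..b}")
      case True
      then have "(\<integral>\<^sup>+x. N (Complex x y) \<partial>lborel) \<le> ennreal (C * y powr - \<alpha>)"
        using line_bound[of y] ab by (simp add: N_def S_def)
      also have "\<dots> \<le> ennreal (C * a powr - \<alpha>)"
        using True ab C_nonneg \<alpha>_nonneg by (intro ennreal_leI mult_left_mono powr_mono2') auto
      finally show ?thesis using True by simp
    qed (simp add: N_def S_def)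
  qed
  also have "\<dots> < \<infinity>" using ab by (simp add: nn_integral_cmult_indicator ennreal_mult_less_top)
  finally have fin: "(\<integral>\<^sup>+x. G x \<partial>lborel) < \<infinity>" .
  have "(\<integral>\<^sup>+x. G (-x) \<partial>lborel) = (\<integral>\<^sup>+x. G x \<partial>lborel)"
    by (subst (2) nn_integral_real_affine[where c = "-1" and t = 0]) auto
  then have fin2: "(\<integral>\<^sup>+R. G R + G (-R) \<partial>lborel) < \<infinity>"
    using fin by (simp add: nn_integral_add)
  then obtain B where B: "B \<ge> 0" "(\<integral>\<^sup>+R. G R + G (-R) \<partial>lborel) = ennreal B"
    by (cases "\<integral>\<^sup>+R. G R + G (-R) \<partial>lborel") auto
  \<comment> \<open>an interval long enough for the lower bound \<open>\<epsilon>\<close> to exceed the total integral \<open>B\<close>\<close>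
  define T where "T = (B + 1) / \<epsilon>"
  have "ennreal (B + 1) = (\<integral>\<^sup>+R. ennreal \<epsilon> * indicator {R\<^sub>0..R\<^sub>0 + T} R \<partial>lborel)"
    using \<open>\<epsilon> > 0\<close> B by (simp add: nn_integral_cmult_indicator ennreal_mult[symmetric] T_def del: ennreal_plus)
  also have "\<dots> \<le> (\<integral>\<^sup>+R. G R + G (-R) \<partial>lborel)"
    by (intro nn_integral_mono) (use large in \<open>auto simp: indicator_def\<close>)
  finally show False using B by (simp add: ennreal_le_iff del: ennreal_plus)
qed

text \<open>A contour identity on all large rectangles passes to the infinite strip: the
horizontal integrals converge, and the vertical ones are small for arbitrarily large rectangles,
which determines the limit. The integrand \<open>g\<close> is \<open>f\<close> times an
exponential (with \<open>c = 0\<close>) or times a Cauchy kernel (with \<open>c\<close> the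
value from the Cauchy formula).\<close>
lemma strip_integral:
  assumes ab: "0 < a" "a < b" and "0 \<le> K"
    and int: "integrable lborel (\<lambda>x. g (Complex x a))" "integrable lborel (\<lambda>x. g (Complex x b))"
    and rect: "\<And>R. R \<ge> R\<^sub>0 \<Longrightarrow> rect_integral g (-R) R a b = c"
    and dom: "\<And>x y. \<bar>x\<bar> \<ge> R\<^sub>0 \<Longrightarrow> y \<in> {a..b} \<Longrightarrow> norm (g (Complex x y)) \<le> K * norm (f (Complex x y))"
  shows "(LINT x|lborel. g (Complex x a)) - (LINT x|lborel. g (Complex x b)) = c"
proof (rule ccontr)
  let ?D = "(LINT x|lborel. g (Complex x a)) - (LINT x|lborel. g (Complex x b)) - c"
  define d where "d = (\<lambda>R. (LINT x:{-R..R}|lborel. g (Complex x a)) - (LINT x:{-R..R}|lborel. g (Complex x b)) - c)"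
  assume "\<not> ?thesis"
  then have D: "norm ?D > 0" by simp
  have "(d \<longlongrightarrow> ?D) at_top"
    unfolding d_def by (intro tendsto_intros tendsto_integral_symmetric_interval int)
  then have "((\<lambda>R. norm (d R)) \<longlongrightarrow> norm ?D) at_top" by (rule tendsto_norm)
  then have "\<forall>\<^sub>F R in at_top. norm ?D / 2 < norm (d R)"
    using D by (intro order_tendstoD) auto
  then obtain R\<^sub>1 where R1: "\<And>R. R \<ge> R\<^sub>1 \<Longrightarrow> norm ?D / 2 < norm (d R)"
    by (auto simp: eventually_at_top_linorder)
  have "norm ?D / (2 * (K + 1)) > 0" using D \<open>0 \<le> K\<close> by simp
  from exists_small_vertical_sides[OF ab this, of "max 0 (max R\<^sub>0 R\<^sub>1)"]
  obtain R where R: "R \<ge> 0" "R \<ge> R\<^sub>0" "R \<ge> R\<^sub>1" and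
    small: "(\<integral>\<^sup>+y. ennreal (norm (f (Complex R y))) * indicator {a..b} y \<partial>lborel)
              + (\<integral>\<^sup>+y. ennreal (norm (f (Complex (-R) y))) * indicator {a..b} y \<partial>lborel) < ennreal (norm ?D / (2 * (K + 1)))"
    by auto
  define V where "V = (\<lambda>x. LINT y:{a..b}|lborel. g (Complex x y))"
  have V: "ennreal (norm (V x)) \<le> ennreal K * (\<integral>\<^sup>+y. ennreal (norm (f (Complex x y))) * indicator {a..b} y \<partial>lborel)"
    if "\<bar>x\<bar> \<ge> R\<^sub>0" for x
  proof -
    have "(\<lambda>y. indicator {a..b} y *\<^sub>R f (Complex x y)) \<in> borel_measurable borel"
      using ab by (intro borel_measurable_continuous_on_indicator
         continuous_on_compose2[OF holomorphic_on_imp_continuous_on[OF hol]])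
         (auto simp: upper_half_plane_def intro!: continuous_intros)
    then have "(\<lambda>y. ennreal (norm (indicator {a..b} y *\<^sub>R f (Complex x y)))) \<in> borel_measurable borel" by measurable
    also have "(\<lambda>y. ennreal (norm (indicator {a..b} y *\<^sub>R f (Complex x y)))) = (\<lambda>y. ennreal (norm (f (Complex x y))) * indicator {a..b} y)"
      by (auto simp: indicator_def)
    finally have m: "(\<lambda>y. ennreal (norm (f (Complex x y))) * indicator {a..b} y) \<in> borel_measurable borel" .
    have "ennreal (norm (V x)) \<le> (\<integral>\<^sup>+y. ennreal (norm (indicator {a..b} y *\<^sub>R g (Complex x y))) \<partial>lborel)"
      unfolding V_def set_lebesgue_integral_def by (rule ennreal_norm_integral_le)
    also have "\<dots> \<le> (\<integral>\<^sup>+y. ennreal K * (ennreal (norm (f (Complex x y))) * indicator {a..b} y) \<partial>lborel)"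
      using dom[OF that] \<open>0 \<le> K\<close> by (intro nn_integral_mono) (auto simp: indicator_def ennreal_mult[symmetric] intro!: ennreal_leI)
    also have "\<dots> = ennreal K * (\<integral>\<^sup>+y. ennreal (norm (f (Complex x y))) * indicator {a..b} y \<partial>lborel)"
      using m by (simp add: nn_integral_cmult)
    finally show ?thesis .
  qed
  have "d R = \<i> * V (-R) - \<i> * V R"
    using rect[OF R(2)] by (simp add: d_def rect_integral_def V_def algebra_simps)
  then have "norm (d R) \<le> norm (V R) + norm (V (-R))"
    using norm_triangle_ineq4[of "\<i> * V (-R)" "\<i> * V R"] by (simp add: norm_mult add.commute)
  then have "ennreal (norm (d R)) \<le> ennreal (norm (V R)) + ennreal (norm (V (-R)))"
    by (simp add: ennreal_plus[symmetric] ennreal_leI del: ennreal_plus)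
  also have "\<dots> \<le> ennreal K * (\<integral>\<^sup>+y. ennreal (norm (f (Complex R y))) * indicator {a..b} y \<partial>lborel)
    + ennreal K * (\<integral>\<^sup>+y. ennreal (norm (f (Complex (-R) y))) * indicator {a..b} y \<partial>lborel)"
    using R by (intro add_mono V) auto
  also have "\<dots> \<le> ennreal K * ennreal (norm ?D / (2 * (K + 1)))"
    unfolding distrib_left[symmetric] using small by (intro mult_left_mono) auto
  also have "\<dots> \<le> ennreal (norm ?D / 2)"
    using \<open>0 \<le> K\<close> by (subst ennreal_mult[symmetric]) (auto intro!: ennreal_leI simp: field_simps)
  finally have "norm (d R) \<le> norm ?D / 2" by (subst (asm) ennreal_le_iff) auto
  with R1[OF R(3)] show False by simp
qed

end

section \<open>The spectrum of a function integrable on horizontal lines\<close>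

context integrable_on_lines
begin

lemma measurable_exp_line: "(\<lambda>x. exp (- \<i> * of_real t * Complex x y)) \<in> borel_measurable borel"
  by (intro borel_measurable_continuous_onI continuous_intros)

lemma norm_inverse_sqrt_2pi_mult_le: "norm (1 / sqrt (2 * pi) * (w::complex)) \<le> norm w"
proof -
  have "1 \<le> sqrt (2 * pi)" using pi_gt3 by simp
  from mult_left_mono[OF this, of "norm w"] show ?thesis
    by (simp add: norm_mult norm_divide divide_le_eq)
qed

text \<open>\<open>f w * exp (- \<i> * t * w)\<close> has no singularity in the strip, and the
exponential is bounded there.\<close>
lemma line_integral_shift:
  assumes ab: "0 < a" "a < b"
  shows "(LINT x|lborel. f (Complex x a) * exp (- \<i> * of_real t * Complex x a))
       = (LINT x|lborel. f (Complex x b) * exp (- \<i> * of_real t * Complex x b))"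
proof -
  let ?g = "\<lambda>w. f w * exp (- \<i> * of_real t * w)"
  have int: "integrable lborel (\<lambda>x. ?g (Complex x y))" if "y > 0" for y
    by (rule integrable_line_mult(1)[OF that, where B = "exp (t * y)"]) (rule measurable_exp_line, auto)
  have "(LINT x|lborel. ?g (Complex x a)) - (LINT x|lborel. ?g (Complex x b)) = 0"
  proof (rule strip_integral[OF ab, where K = "exp (\<bar>t\<bar> * b)" and R\<^sub>0 = 1])
    show "rect_integral ?g (- R) R a b = 0" if "R \<ge> 1" for R
      using that ab
      by (intro rect_integral_eq_0[OF _ _ _ open_upper_half_plane convex_upper_half_plane] holomorphic_intros hol)
         (auto simp: upper_half_plane_def in_cbox_complex_iff)
    show "norm (?g (Complex x y)) \<le> exp (\<bar>t\<bar> * b) * norm (f (Complex x y))" if "y \<in> {a..b}" for x y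
    proof -
      have "t * y \<le> \<bar>t\<bar> * b" using that ab by (intro mult_mono) auto
      then show ?thesis using mult_right_mono[of "exp (t * y)" "exp (\<bar>t\<bar> * b)" "norm (f (Complex x y))"]
        by (simp add: norm_mult mult.commute)
    qed
  qed (use int ab in auto)
  then show ?thesis by simp
qed

text \<open>In the Cauchy formula for the strip \<open>a \<le> Im w \<le> b\<close> the
contribution of the upper line is at most its \<open>L\<^sup>1\<close> norm divided by \<open>b
- Im z\<close>. The norms stay bounded as \<open>b\<close> grows, so this contribution
disappears.\<close>
lemma Cauchy_formula_half_plane:
  assumes a: "0 < a" "a < Im z"
  shows "(LINT x|lborel. f (Complex x a) * (1 / (Complex x a - z))) = 2 * pi * \<i> * f z"
proof -
  let ?g = "\<lambda>w. f w * (1 / (w - z))"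
  have int: "integrable lborel (\<lambda>x. ?g (Complex x y))"
    and bnd: "norm (LINT x|lborel. ?g (Complex x y)) \<le> 1 / \<bar>Im z - y\<bar> * (C * y powr - \<alpha>)"
    if y: "y > 0" "y \<noteq> Im z" for y
  proof -
    have "norm (1 / (Complex x y - z)) \<le> 1 / \<bar>Im z - y\<bar>" for x
    proof -
      have "0 < \<bar>Im z - y\<bar>" "\<bar>Im z - y\<bar> \<le> norm (Complex x y - z)"
        using abs_Im_le_cmod[of "Complex x y - z"] y by auto
      then show ?thesis by (simp add: norm_divide frac_le)
    qed
    moreover have "(\<lambda>x. 1 / (Complex x y - z)) \<in> borel_measurable borel" by measurable
    ultimately show "integrable lborel (\<lambda>x. ?g (Complex x y))"
        "norm (LINT x|lborel. ?g (Complex x y)) \<le> 1 / \<bar>Im z - y\<bar> * (C * y powr - \<alpha>)"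
      using integrable_line_mult[OF y(1)] by blast+
  qed
  have strip: "(LINT x|lborel. ?g (Complex x a)) - 2 * pi * \<i> * f z = (LINT x|lborel. ?g (Complex x b))"
    if b: "b > Im z" for b
  proof -
    have "(LINT x|lborel. ?g (Complex x a)) - (LINT x|lborel. ?g (Complex x b)) = 2 * pi * \<i> * f z"
    proof (rule strip_integral[where K = 1 and R\<^sub>0 = "\<bar>Re z\<bar> + 1"])
      show "rect_integral ?g (- R) R a b = 2 * pi * \<i> * f z" if "R \<ge> \<bar>Re z\<bar> + 1" for R
      proof -
        have "z \<in> box (Complex (- R) a) (Complex R b)" using that a b by (auto simp: in_box_complex_iff)
        moreover have "cbox (Complex (- R) a) (Complex R b) \<subseteq> upper_half_plane"
          using a by (auto simp: upper_half_plane_def in_cbox_complex_iff)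
        ultimately show ?thesis
          using rect_integral_Cauchy_formula[OF _ hol open_upper_half_plane convex_upper_half_plane] by simp
      qed
      show "norm (?g (Complex x y)) \<le> 1 * norm (f (Complex x y))" if "\<bar>x\<bar> \<ge> \<bar>Re z\<bar> + 1" for x y
      proof -
        have "1 \<le> norm (Complex x y - z)"
          using that abs_Re_le_cmod[of "Complex x y - z"] by auto
        from mult_left_mono[OF this, of "norm (f (Complex x y))"]
        show ?thesis by (simp add: norm_mult norm_divide divide_le_eq)
      qed
    qed (use a b int in auto)
    then show ?thesis by (simp add: algebra_simps)
  qed
  define D where "D = norm ((LINT x|lborel. ?g (Complex x a)) - 2 * pi * \<i> * f z)"
  have D_le: "D \<le> (C * Im z powr - \<alpha>) / (b - Im z)" if b: "b > Im z" for b
  proof -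
    have "D \<le> 1 / \<bar>Im z - b\<bar> * (C * b powr - \<alpha>)"
      unfolding D_def strip[OF b] using a b by (intro bnd) auto
    also have "\<dots> \<le> 1 / \<bar>Im z - b\<bar> * (C * Im z powr - \<alpha>)"
      using a b C_nonneg \<alpha>_nonneg by (intro mult_left_mono powr_mono2') auto
    finally show ?thesis using b by simp
  qed
  have "\<forall>\<^sub>F b in at_top. D \<le> (C * Im z powr - \<alpha>) / (b - Im z)"
    using eventually_gt_at_top[of "Im z"] by eventually_elim (rule D_le)
  moreover have "((\<lambda>b. (C * Im z powr - \<alpha>) / (b - Im z)) \<longlongrightarrow> 0) at_top"
    by (intro tendsto_divide_0[OF tendsto_const] filterlim_at_top_imp_at_infinity
        filterlim_tendsto_add_at_top[of "\<lambda>_. - Im z", simplified] filterlim_ident) (auto intro!: tendsto_const filterlim_ident)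
  ultimately have "D \<le> 0" by (intro tendsto_lowerbound) auto
  then show ?thesis by (simp add: D_def)
qed

text \<open>The Fourier transform of \<open>f\<close> on the line at height \<open>y\<close>,
multiplied by \<open>exp (t * y)\<close> through the complex argument of the exponential. By the
shift of contours it is the same for every \<open>y > 0\<close>; height 1 is an arbitrary
choice.\<close>
definition spectrum :: "real \<Rightarrow> complex" where
  "spectrum t = 1 / sqrt (2 * pi) * (LINT x|lborel. f (Complex x 1) * exp (- \<i> * of_real t * Complex x 1))"

lemma spectrum_eq:
  assumes "0 < y"
  shows "spectrum t = 1 / sqrt (2 * pi) * (LINT x|lborel. f (Complex x y) * exp (- \<i> * of_real t * Complex x y))"
  using line_integral_shift[of 1 y t] line_integral_shift[of y 1 t] assms
  unfolding spectrum_def by (cases y "1::real" rule: linorder_cases) auto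

lemma norm_spectrum_le:
  assumes "0 < y"
  shows "norm (spectrum t) \<le> exp (t * y) * (C * y powr - \<alpha>)"
proof -
  have "norm (spectrum t) \<le> norm (LINT x|lborel. f (Complex x y) * exp (- \<i> * of_real t * Complex x y))"
    unfolding spectrum_eq[OF assms] by (rule norm_inverse_sqrt_2pi_mult_le)
  also have "\<dots> \<le> exp (t * y) * (C * y powr - \<alpha>)"
    by (rule integrable_line_mult(2)[OF assms]) (rule measurable_exp_line, auto)
  finally show ?thesis .
qed

text \<open>The height \<open>y\<close> in the bound for the spectrum is free. For negative
\<open>t\<close> it is sent to infinity; for positive \<open>t\<close>, \<open>y = 1 / t\<close>
balances the two factors; for \<open>t = 0\<close> sending it to infinity helps only if
\<open>\<alpha> > 0\<close>.\<close>
lemma spectrum_negative: "spectrum t = 0" if "t < 0"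
proof -
  have "\<forall>\<^sub>F y in at_top. norm (spectrum t) \<le> exp (t * y) * C"
    using eventually_ge_at_top[of 1]
  proof eventually_elim
    case (elim y)
    have "y powr - \<alpha> \<le> 1 powr - \<alpha>" using elim \<alpha>_nonneg by (intro powr_mono2') auto
    then have "C * y powr - \<alpha> \<le> C" using C_nonneg by (simp add: mult_left_le)
    then have "exp (t * y) * (C * y powr - \<alpha>) \<le> exp (t * y) * C" by (intro mult_left_mono) auto
    with norm_spectrum_le[of y t] elim show ?case by (auto intro: order.trans)
  qed
  moreover have "((\<lambda>y. exp (t * y) * C) \<longlongrightarrow> 0) at_top"
    using that by real_asymp
  ultimately have "norm (spectrum t) \<le> 0" by (intro tendsto_lowerbound) auto
  then show ?thesis by simp
qed

lemma norm_spectrum_le_powr: "norm (spectrum t) \<le> exp 1 * C * t powr \<alpha>" if "0 < t"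
  using norm_spectrum_le[of "1 / t" t] that by (simp add: powr_minus powr_divide mult_ac)

lemma norm_spectrum_0: "norm (spectrum 0) \<le> C * (if \<alpha> = 0 then 1 else 0)"
proof (cases "\<alpha> = 0")
  case True
  then show ?thesis using norm_spectrum_le[of 1 0] by simp
next
  case False
  have "\<forall>\<^sub>F y in at_top. norm (spectrum 0) \<le> C * y powr - \<alpha>"
    using eventually_gt_at_top[of 0] by eventually_elim (use norm_spectrum_le[of _ 0] in simp)
  moreover have "((\<lambda>y. C * y powr - \<alpha>) \<longlongrightarrow> 0) at_top"
    using False \<alpha>_nonneg by real_asymp
  ultimately have "norm (spectrum 0) \<le> 0" by (intro tendsto_lowerbound) auto
  then show ?thesis using False by simp
qed

lemma continuous_spectrum: "continuous_on UNIV spectrum"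
proof -
  have "isCont spectrum t" for t
    unfolding continuous_within tendsto_at_iff_sequentially spectrum_def comp_def
  proof (intro allI impI tendsto_intros)
    fix X assume "\<forall>i. X i \<in> UNIV - {t}" and X: "X \<longlonglongrightarrow> t"
    from X obtain B where B: "\<And>n. norm (X n) \<le> B"
      by (meson convergentI convergent_imp_Bseq BseqE)
    show "(\<lambda>n. LINT x|lborel. f (Complex x 1) * exp (- \<i> * of_real (X n) * Complex x 1))
        \<longlonglongrightarrow> (LINT x|lborel. f (Complex x 1) * exp (- \<i> * of_real t * Complex x 1))"
    proof (rule integral_dominated_convergence[where w = "\<lambda>x. exp B * norm (f (Complex x 1))"])
      show "integrable lborel (\<lambda>x. exp B * norm (f (Complex x 1)))"
        using integrable_line[of 1] by auto
      show "AE x in lborel. norm (f (Complex x 1) * exp (- \<i> * of_real (X n) * Complex x 1)) \<le> exp B * norm (f (Complex x 1))" for n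
        using B[of n] by (auto simp: norm_mult mult.commute intro!: mult_right_mono AE_I2)
      show "AE x in lborel. (\<lambda>n. f (Complex x 1) * exp (- \<i> * of_real (X n) * Complex x 1)) \<longlonglongrightarrow> f (Complex x 1) * exp (- \<i> * of_real t * Complex x 1)"
        by (intro AE_I2 tendsto_intros X)
    qed (use measurable_horizontal_line[OF hol, of 1] in \<open>auto intro!: borel_measurable_times measurable_exp_line\<close>)
  qed
  then show ?thesis by (simp add: continuous_at_imp_continuous_on)
qed

end

section \<open>Representation formulas\<close>

text \<open>Both applications of Fubini's theorem below concern a kernel dominated by a product
of integrable functions of one variable.\<close>
lemma integrable_prod_dominated:
  fixes h :: "real \<times> real \<Rightarrow> complex" and u v :: "real \<Rightarrow> complex"
  assumes [measurable]: "h \<in> borel_measurable (lborel \<Otimes>\<^sub>M lborel)"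
    and u: "integrable lborel u" and v: "integrable lborel v"
    and le: "\<And>x t. norm (h (x, t)) \<le> norm (u x) * norm (v t)"
  shows "integrable (lborel \<Otimes>\<^sub>M lborel) h"
proof -
  note [measurable] = borel_measurable_integrable[OF u] borel_measurable_integrable[OF v]
  have "integrable (lborel \<Otimes>\<^sub>M lborel) (\<lambda>(x, t). u x * v t)"
    using u v by (intro lborel_pair.Fubini_integrable) (auto simp: norm_mult)
  then show ?thesis
    by (rule Bochner_Integration.integrable_bound) (use le in \<open>auto simp: norm_mult\<close>)
qed

lemma set_integrable_exp_Ici:
  assumes "Re c < 0"
  shows "set_integrable lborel {0..} (\<lambda>t::real. exp (of_real t * c))"
  unfolding set_integrable_def
proof (rule integrableI_bounded)
  have m: "(\<lambda>t::real. exp (of_real t * c)) \<in> borel_measurable borel"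
    by (intro borel_measurable_continuous_onI continuous_intros)
  then show "(\<lambda>t. indicator {0..} t *\<^sub>R exp (complex_of_real t * c)) \<in> borel_measurable lborel" by measurable
  have "(\<integral>\<^sup>+t. ennreal (norm (indicator {0..} t *\<^sub>R exp (complex_of_real t * c))) \<partial>lborel)
      = (\<integral>\<^sup>+t. ennreal (exp (t * Re c)) * indicator {0..} t \<partial>lborel)"
    by (intro nn_integral_cong) (auto simp: indicator_def)
  also have "\<dots> = ennreal (0 - exp (0 * Re c) / Re c)"
  proof (rule nn_integral_FTC_atLeast)
    show "((\<lambda>t. exp (t * Re c) / Re c) \<longlongrightarrow> 0) at_top" using assms by real_asymp
    show "((\<lambda>t. exp (t * Re c) / Re c) has_real_derivative exp (t * Re c)) (at t)" for t
      using assms by (auto intro!: derivative_eq_intros)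
  qed auto
  finally show "(\<integral>\<^sup>+t. ennreal (norm (indicator {0..} t *\<^sub>R exp (complex_of_real t * c))) \<partial>lborel) < \<infinity>"
    by simp
qed

lemma integral_exp_Ici:
  assumes "Re c < 0"
  shows "(LINT t:{0..}|lborel. exp (of_real t * c)) = - 1 / c"
proof -
  have c: "c \<noteq> 0" using assms by auto
  have "((\<lambda>b. LINT t:{0..b}|lborel. exp (of_real t * c)) \<longlongrightarrow> (LINT t:{0..}|lborel. exp (of_real t * c))) at_top"
    by (intro tendsto_set_lebesgue_integral_at_top set_integrable_exp_Ici assms) auto
  moreover have "((\<lambda>b. LINT t:{0..b}|lborel. exp (of_real t * c)) \<longlongrightarrow> 0 - 1 / c) at_top"
  proof (rule Lim_transform_eventually)
    show "\<forall>\<^sub>F b in at_top. exp (of_real b * c) / c - 1 / c = (LINT t:{0..b}|lborel. exp (of_real t * c))"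
      using eventually_ge_at_top[of 0]
    proof eventually_elim
      case (elim b)
      have "(LINT t:{0..b}|lborel. exp (of_real t * c)) = exp (of_real b * c) / c - exp (of_real 0 * c) / c"
        unfolding set_lebesgue_integral_def
      proof (rule integral_FTC_Icc[OF elim])
        show "((\<lambda>t. exp (of_real t * c) / c) has_vector_derivative exp (of_real t * c)) (at t within {0..b})" for t
          using c by (auto intro!: derivative_eq_intros has_vector_derivative_real_field)
      qed (auto intro!: continuous_intros)
      then show ?case by simp
    qed
    have "((\<lambda>b. exp (b * Re c)) \<longlongrightarrow> 0) at_top" using assms by real_asymp
    then have "((\<lambda>b. exp (of_real b * c)) \<longlongrightarrow> 0) at_top"
      by (subst tendsto_norm_zero_iff[symmetric]) simp
    then have "((\<lambda>b. exp (of_real b * c) / c) \<longlongrightarrow> 0 / c) at_top"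
      by (intro tendsto_intros c)
    then show "((\<lambda>b. exp (of_real b * c) / c - 1 / c) \<longlongrightarrow> 0 - 1 / c) at_top"
      by (intro tendsto_intros) simp
  qed
  ultimately show ?thesis by (auto dest: tendsto_unique[rotated])
qed

lemma integrable_inverse_1_plus_square: "integrable lborel (\<lambda>x::real. 1 / (1 + x\<^sup>2))"
proof (rule integrableI_bounded)
  let ?H = "\<lambda>x::real. ennreal (1 / (1 + x\<^sup>2))"
  have pos: "0 < 1 + x\<^sup>2" for x :: real by (simp add: add_pos_nonneg)
  have "(\<integral>\<^sup>+x. ?H x * indicator {0..} x \<partial>lborel) = ennreal (pi / 2 - arctan 0)"
    using pos by (intro nn_integral_FTC_atLeast tendsto_arctan_at_top)
      (auto intro!: derivative_eq_intros simp: inverse_eq_divide add_nonneg_nonneg)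
  then have fin: "(\<integral>\<^sup>+x. ?H x * indicator {0..} x \<partial>lborel) < \<infinity>" by simp
  have "(\<integral>\<^sup>+x. ?H x * indicator {..0} x \<partial>lborel) = (\<integral>\<^sup>+x. ?H x * indicator {0..} x \<partial>lborel)"
    by (subst nn_integral_real_affine[where c = "-1" and t = 0]) (auto simp: indicator_def)
  with fin have "(\<integral>\<^sup>+x. ?H x * indicator {0..} x + ?H x * indicator {..0} x \<partial>lborel) < \<infinity>"
    by (subst nn_integral_add) auto
  moreover have "(\<integral>\<^sup>+x. ?H x \<partial>lborel) \<le> (\<integral>\<^sup>+x. ?H x * indicator {0..} x + ?H x * indicator {..0} x \<partial>lborel)"
    by (intro nn_integral_mono) (auto simp: indicator_def)
  ultimately show "(\<integral>\<^sup>+x. ennreal (norm (1 / (1 + (x::real)\<^sup>2))) \<partial>lborel) < \<infinity>"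
    using pos by (simp add: abs_of_pos[OF divide_pos_pos[OF zero_less_one pos]])
qed auto

lemma one_plus_square_power_le: "(1 + x\<^sup>2) ^ n \<le> 2 ^ n * (1 + \<bar>x\<bar> ^ (2 * n))" for x :: real
proof -
  have "(1 + x\<^sup>2) ^ n \<le> (2 * max 1 (x\<^sup>2)) ^ n" by (intro power_mono) auto
  also have "\<dots> = 2 ^ n * max 1 (x\<^sup>2) ^ n" by (simp add: power_mult_distrib)
  also have "max 1 (x\<^sup>2) ^ n \<le> 1 + (x\<^sup>2) ^ n" by (auto simp: max_def)
  also have "(x\<^sup>2) ^ n = \<bar>x\<bar> ^ (2 * n)" by (simp add: power_mult)
  finally show ?thesis by simp
qed

lemma schwartz_continuous: "\<phi> \<in> schwartz \<Longrightarrow> continuous_on UNIV \<phi>"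
proof -
  assume "\<phi> \<in> schwartz"
  then have "iter_deriv 0 \<phi> differentiable (at x)" for x by (simp add: schwartz_def)
  then show ?thesis
    by (auto simp: iter_deriv_def intro!: continuous_at_imp_continuous_on differentiable_imp_continuous_within)
qed

lemma schwartz_decay:
  assumes "\<phi> \<in> schwartz"
  obtains D where "D \<ge> 0" "\<And>x. norm (\<phi> x) * (1 + x\<^sup>2) ^ n \<le> D"
proof -
  have bd: "bounded (range (\<lambda>x. of_real (x ^ j) * \<phi> x))" for j
  proof -
    have "bounded (range (\<lambda>x. of_real (x ^ j) * iter_deriv 0 \<phi> x))"
      using assms unfolding schwartz_def by blast
    then show ?thesis by (simp add: iter_deriv_def)
  qed
  from bd[of 0] obtain B where B: "\<And>x. norm (\<phi> x) \<le> B" by (auto simp: bounded_iff)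
  from bd[of "2 * n"] obtain E where E: "\<And>x. \<bar>x\<bar> ^ (2 * n) * norm (\<phi> x) \<le> E"
    by (auto simp: bounded_iff norm_mult norm_power)
  have "norm (\<phi> x) * (1 + x\<^sup>2) ^ n \<le> 2 ^ n * (B + E)" for x
  proof -
    have "norm (\<phi> x) * (1 + x\<^sup>2) ^ n \<le> norm (\<phi> x) * (2 ^ n * (1 + \<bar>x\<bar> ^ (2 * n)))"
      by (intro mult_left_mono one_plus_square_power_le) auto
    also have "\<dots> = 2 ^ n * (norm (\<phi> x) + \<bar>x\<bar> ^ (2 * n) * norm (\<phi> x))" by (simp add: algebra_simps)
    also have "\<dots> \<le> 2 ^ n * (B + E)" by (intro mult_left_mono add_mono B E) auto
    finally show ?thesis .
  qed
  moreover have "0 \<le> B + E"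
    using order.trans[OF _ B[of 0]] order.trans[OF _ E[of 0]] by (simp add: add_nonneg_nonneg)
  ultimately show ?thesis by (intro that[of "2 ^ n * (B + E)"]) auto
qed

text \<open>Two more powers of \<open>x\<close> than needed to cancel the growth of
\<open>F\<close> leave the integrable majorant \<open>1 / (1 + x\<^sup>2)\<close>.\<close>
lemma integrable_growth_mult_schwartz:
  assumes \<phi>: "\<phi> \<in> schwartz" and F: "F \<in> borel_measurable borel" "\<And>t. norm (F t) \<le> E * (1 + t\<^sup>2) ^ m"
  shows "integrable lborel (\<lambda>t. F t * \<phi> t)"
proof -
  obtain D where D: "D \<ge> 0" "\<And>x. norm (\<phi> x) * (1 + x\<^sup>2) ^ Suc m \<le> D"
    using schwartz_decay[OF \<phi>] by metis
  have E: "E \<ge> 0" using order.trans[OF norm_ge_zero F(2)[of 0]] by simp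
  have [measurable]: "\<phi> \<in> borel_measurable borel" 
    using schwartz_continuous[OF \<phi>] by (rule borel_measurable_continuous_onI)
  note [measurable] = F(1)
  show ?thesis
  proof (rule Bochner_Integration.integrable_bound)
    show "integrable lborel (\<lambda>x. (E * D) * (1 / (1 + x\<^sup>2)))"
      by (intro integrable_mult_right integrable_inverse_1_plus_square)
    show "AE x in lborel. norm (F x * \<phi> x) \<le> norm (E * D * (1 / (1 + x\<^sup>2)))"
    proof (intro AE_I2)
      fix x :: real
      have pos: "0 < 1 + x\<^sup>2" by (simp add: add_pos_nonneg)
      have "norm (F x * \<phi> x) * (1 + x\<^sup>2) \<le> (E * (1 + x\<^sup>2) ^ m) * norm (\<phi> x) * (1 + x\<^sup>2)"
        unfolding norm_mult using pos by (intro mult_right_mono F(2)) auto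
      also have "\<dots> = E * (norm (\<phi> x) * (1 + x\<^sup>2) ^ Suc m)" by simp
      also have "\<dots> \<le> E * D" using D(2)[of x] E by (intro mult_left_mono)
      finally have "norm (F x * \<phi> x) \<le> E * D / (1 + x\<^sup>2)"
        using pos by (simp add: pos_le_divide_eq)
      then show "norm (F x * \<phi> x) \<le> norm (E * D * (1 / (1 + x\<^sup>2)))" using E D pos by simp
    qed
  qed measurable
qed

lemma schwartz_integrable: "\<phi> \<in> schwartz \<Longrightarrow> integrable lborel \<phi>"
  using integrable_growth_mult_schwartz[of \<phi> "\<lambda>_. 1" 1 0] by simp

context integrable_on_lines
begin

lemma measurable_spectrum: "spectrum \<in> borel_measurable borel"
  using continuous_spectrum by (rule borel_measurable_continuous_onI)

text \<open>A polynomial majorant for \<open>t powr \<alpha>\<close> that also covers \<open>t =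
0\<close>, where the spectrum may only be bounded by \<open>C\<close>.\<close>
lemma norm_spectrum_le_poly: "norm (spectrum t) \<le> exp 1 * C * (1 + t\<^sup>2) ^ Suc (nat \<lceil>\<alpha>\<rceil>)"
proof -
  have one: "1 \<le> (1 + t\<^sup>2) ^ Suc (nat \<lceil>\<alpha>\<rceil>)" by (intro one_le_power) auto
  have e1: "C \<le> exp 1 * C" using C_nonneg mult_right_mono[of 1 "exp 1" C] by simp
  consider "t < 0" | "t = 0" | "t > 0" by linarith
  then show ?thesis
  proof cases
    case 1
    then show ?thesis using spectrum_negative C_nonneg by simp
  next
    case 2
    then show ?thesis using norm_spectrum_0 e1 C_nonneg by (auto split: if_splits intro: order.trans)
  next
    case 3
    have "t \<le> 1 + t\<^sup>2" using 3 zero_le_power2[of "t - 1"]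
      by (simp add: power2_diff)
    then have "t powr \<alpha> \<le> (1 + t\<^sup>2) powr \<alpha>" using 3 \<alpha>_nonneg by (intro powr_mono2) auto
    also have "\<dots> \<le> (1 + t\<^sup>2) powr (real (Suc (nat \<lceil>\<alpha>\<rceil>)))"
    proof (intro powr_mono)
      show "\<alpha> \<le> real (Suc (nat \<lceil>\<alpha>\<rceil>))" using real_nat_ceiling_ge[of \<alpha>] by simp
    qed simp
    also have "\<dots> = (1 + t\<^sup>2) ^ Suc (nat \<lceil>\<alpha>\<rceil>)" by (intro powr_realpow) (simp add: add_pos_nonneg)
    finally have "exp 1 * C * t powr \<alpha> \<le> exp 1 * C * (1 + t\<^sup>2) ^ Suc (nat \<lceil>\<alpha>\<rceil>)"
      using C_nonneg by (intro mult_left_mono) auto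
    with norm_spectrum_le_powr[OF 3] show ?thesis by linarith
  qed
qed

lemma slowly_increasing_spectrum: "slowly_increasing spectrum"
proof -
  have "norm (spectrum t / of_real ((1 + t\<^sup>2) ^ Suc (nat \<lceil>\<alpha>\<rceil>))) \<le> exp 1 * C" for t
  proof -
    have "0 < 1 + t\<^sup>2" by (simp add: add_pos_nonneg)
    then have "0 < (1 + t\<^sup>2) ^ Suc (nat \<lceil>\<alpha>\<rceil>)" by (rule zero_less_power)
    then show ?thesis using norm_spectrum_le_poly[of t]
      by (simp add: norm_divide pos_divide_le_eq del: power_Suc of_real_power)
  qed
  moreover have "spectrum \<in> borel_measurable lebesgue"
    using measurable_spectrum by (simp add: measurable_completion)
  ultimately show ?thesis unfolding slowly_increasing_def
    by (intro conjI exI[of _ "Suc (nat \<lceil>\<alpha>\<rceil>)"] exI[of _ "exp 1 * C"] AE_I2) auto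
qed

text \<open>Inserting the definition of the spectrum at a height \<open>a < Im z\<close> and
exchanging the integrals, which is legitimate because \<open>exp (t * (a - Im z))\<close>
decays, the integral over \<open>t\<close> of an exponential is the Cauchy kernel, and the
Cauchy formula in the half-plane above height \<open>a\<close> recovers \<open>f
z\<close>.\<close>
lemma spectrum_inversion:
  assumes z: "z \<in> upper_half_plane"
  shows "set_integrable lborel {0..} (\<lambda>t. spectrum t * exp (\<i> * of_real t * z))"
    and "f z = 1 / sqrt (2 * pi) * (LINT t:{0..}|lborel. spectrum t * exp (\<i> * of_real t * z))"
proof -
  define a where "a = Im z / 2"
  have a: "0 < a" "a < Im z" using z by (auto simp: a_def upper_half_plane_def)
  have v: "set_integrable lborel {0..} (\<lambda>t. exp (complex_of_real t * of_real (a - Im z)))"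
    by (rule set_integrable_exp_Ici) (use a in auto)
  note [measurable] = measurable_spectrum
  have [measurable]: "(\<lambda>t. exp (\<i> * complex_of_real t * z)) \<in> borel_measurable borel"
    by (intro borel_measurable_continuous_onI continuous_intros)
  show "set_integrable lborel {0..} (\<lambda>t. spectrum t * exp (\<i> * of_real t * z))"
    unfolding set_integrable_def
  proof (rule Bochner_Integration.integrable_bound)
    show "integrable lborel (\<lambda>t. (C * a powr - \<alpha>) *\<^sub>R (indicator {0..} t *\<^sub>R exp (complex_of_real t * of_real (a - Im z))))"
      using v unfolding set_integrable_def by (rule integrable_scaleR_right)
    show "AE t in lborel. norm (indicator {0..} t *\<^sub>R (spectrum t * exp (\<i> * of_real t * z)))
        \<le> norm ((C * a powr - \<alpha>) *\<^sub>R (indicator {0..} t *\<^sub>R exp (complex_of_real t * of_real (a - Im z))))"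
    proof (intro AE_I2)
      fix t
      have "norm (spectrum t) * exp (- t * Im z) \<le> exp (t * a) * (C * a powr - \<alpha>) * exp (- t * Im z)"
        by (intro mult_right_mono norm_spectrum_le a) auto
      also have "\<dots> = C * a powr - \<alpha> * exp (t * (a - Im z))"
        by (simp add: right_diff_distrib exp_diff exp_minus field_simps)
      finally show "norm (indicator {0..} t *\<^sub>R (spectrum t * exp (\<i> * of_real t * z)))
        \<le> norm ((C * a powr - \<alpha>) *\<^sub>R (indicator {0..} t *\<^sub>R exp (complex_of_real t * of_real (a - Im z))))"
        using C_nonneg by (auto simp: norm_mult indicator_def)
    qed
  qed measurable
  define h where "h = (\<lambda>x t. f (Complex x a) * (indicator {0..} t *\<^sub>R exp (of_real t * (\<i> * (z - Complex x a)))))"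
  have exp_split: "exp (of_real t * (\<i> * (z - Complex x a))) = exp (- \<i> * of_real t * Complex x a) * exp (\<i> * of_real t * z)" for x t
    by (simp add: exp_add[symmetric] algebra_simps)
  have "integrable (lborel \<Otimes>\<^sub>M lborel) (\<lambda>(x, t). h x t)"
  proof (rule integrable_prod_dominated)
    show "integrable lborel (\<lambda>x. f (Complex x a))" by (rule integrable_line[OF a(1)])
    show "integrable lborel (\<lambda>t. indicator {0..} t *\<^sub>R exp (complex_of_real t * of_real (a - Im z)))"
      using v unfolding set_integrable_def .
    have [measurable]: "(\<lambda>x. f (Complex x a)) \<in> borel_measurable borel"
      by (rule measurable_horizontal_line[OF hol a(1)])
    have "(\<lambda>(x, t). exp (of_real t * (\<i> * (z - Complex x a)))) \<in> borel_measurable borel"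
      unfolding case_prod_unfold by (intro borel_measurable_continuous_onI continuous_intros)
    then have [measurable]: "(\<lambda>(x, t). exp (of_real t * (\<i> * (z - Complex x a)))) \<in> borel_measurable (borel \<Otimes>\<^sub>M borel)"
      by (simp add: borel_prod)
    show "(\<lambda>(x, t). h x t) \<in> borel_measurable (lborel \<Otimes>\<^sub>M lborel)"
      unfolding h_def by measurable
  qed (auto simp: h_def norm_mult indicator_def algebra_simps)
  then have fubini: "(LINT t|lborel. LINT x|lborel. h x t) = (LINT x|lborel. LINT t|lborel. h x t)"
    by (intro lborel_pair.Fubini_integral) simp
  have "(LINT t:{0..}|lborel. spectrum t * exp (\<i> * of_real t * z)) = (LINT t|lborel. 1 / sqrt (2 * pi) * (LINT x|lborel. h x t))"
    unfolding set_lebesgue_integral_def spectrum_eq[OF a(1)] h_def exp_split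
    by (intro Bochner_Integration.integral_cong) (auto simp: indicator_def mult.assoc[symmetric])
  also have "\<dots> = 1 / sqrt (2 * pi) * (LINT x|lborel. LINT t|lborel. h x t)"
    unfolding fubini[symmetric] by (rule integral_mult_right_zero)
  also have "(LINT x|lborel. LINT t|lborel. h x t) = (LINT x|lborel. - \<i> * (f (Complex x a) * (1 / (Complex x a - z))))"
  proof (intro Bochner_Integration.integral_cong refl)
    fix x
    have ne: "Complex x a - z \<noteq> 0" using a by (auto simp: complex_eq_iff)
    have "(LINT t|lborel. h x t) = f (Complex x a) * (LINT t:{0..}|lborel. exp (of_real t * (\<i> * (z - Complex x a))))"
      unfolding h_def set_lebesgue_integral_def by (rule integral_mult_right_zero)
    also have "\<dots> = f (Complex x a) * (- 1 / (\<i> * (z - Complex x a)))"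
      using a by (subst integral_exp_Ici) auto
    also have "- 1 / (\<i> * (z - Complex x a)) = - \<i> * (1 / (Complex x a - z))"
      using ne by (simp add: field_simps)
    finally show "(LINT t|lborel. h x t) = - \<i> * (f (Complex x a) * (1 / (Complex x a - z)))" by simp
  qed
  also have "\<dots> = - \<i> * (2 * pi * \<i> * f z)"
    unfolding Cauchy_formula_half_plane[OF a, symmetric] by (rule integral_mult_right_zero)
  also have "\<dots> = 2 * pi * f z" by (simp add: algebra_simps)
  finally have *: "(LINT t:{0..}|lborel. spectrum t * exp (\<i> * of_real t * z)) = 1 / sqrt (2 * pi) * (2 * pi * f z)" .
  have "complex_of_real (sqrt (2 * pi)) * of_real (sqrt (2 * pi)) = 2 * pi"
    unfolding of_real_mult[symmetric] by simp
  then show "f z = 1 / sqrt (2 * pi) * (LINT t:{0..}|lborel. spectrum t * exp (\<i> * of_real t * z))"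
    unfolding * by (simp add: field_simps)
qed

text \<open>Moving the Fourier transform from \<open>\<phi>\<close> to \<open>f\<close> produces
the spectrum damped by \<open>exp (- (t * y))\<close>.\<close>
lemma integrable_line_fourier:
  assumes \<phi>: "\<phi> \<in> schwartz" and y: "0 < y"
  shows "integrable lborel (\<lambda>x. f (Complex x y) * fourier \<phi> x)"
    and "(LINT x|lborel. f (Complex x y) * fourier \<phi> x) = (LINT t|lborel. exp (- (t * y)) *\<^sub>R (spectrum t * \<phi> t))"
proof -
  have [measurable]: "\<phi> \<in> borel_measurable borel" 
    using schwartz_continuous[OF \<phi>] by (rule borel_measurable_continuous_onI)
  have [measurable]: "(\<lambda>x. f (Complex x y)) \<in> borel_measurable borel"
    by (rule measurable_horizontal_line[OF hol y])
  have "(\<lambda>(x, t). exp (- \<i> * complex_of_real x * of_real t)) \<in> borel_measurable borel"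
    unfolding case_prod_unfold by (intro borel_measurable_continuous_onI continuous_intros)
  then have [measurable]: "(\<lambda>(x, t). exp (- \<i> * complex_of_real x * of_real t)) \<in> borel_measurable (borel \<Otimes>\<^sub>M borel)"
    by (simp add: borel_prod)
  define h where "h = (\<lambda>x t. f (Complex x y) * (\<phi> t * exp (- \<i> * complex_of_real x * of_real t)))"
  have h: "integrable (lborel \<Otimes>\<^sub>M lborel) (\<lambda>(x, t). h x t)"
  proof (rule integrable_prod_dominated)
    show "integrable lborel (\<lambda>x. f (Complex x y))" by (rule integrable_line[OF y])
    show "integrable lborel \<phi>" by (rule schwartz_integrable[OF \<phi>])
    show "(\<lambda>(x, t). h x t) \<in> borel_measurable (lborel \<Otimes>\<^sub>M lborel)"
      unfolding h_def by measurable
  qed (auto simp: h_def norm_mult)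
  have fh: "f (Complex x y) * fourier \<phi> x = 1 / sqrt (2 * pi) * (LINT t|lborel. h x t)" for x
    unfolding fourier_def h_def by simp
  show "integrable lborel (\<lambda>x. f (Complex x y) * fourier \<phi> x)"
    unfolding fh using lborel_pair.integrable_fst[of "\<lambda>x t. h x t"] h by (intro integrable_mult_right) simp
  have "(LINT x|lborel. f (Complex x y) * fourier \<phi> x) = 1 / sqrt (2 * pi) * (LINT x|lborel. LINT t|lborel. h x t)"
    unfolding fh by (rule integral_mult_right_zero)
  also have "(LINT x|lborel. LINT t|lborel. h x t) = (LINT t|lborel. LINT x|lborel. h x t)"
    by (rule lborel_pair.Fubini_integral[symmetric]) (use h in simp)
  also have "1 / sqrt (2 * pi) * \<dots> = (LINT t|lborel. 1 / sqrt (2 * pi) * (LINT x|lborel. h x t))"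
    by (rule integral_mult_right_zero[symmetric])
  also have "\<dots> = (LINT t|lborel. exp (- (t * y)) *\<^sub>R (spectrum t * \<phi> t))"
  proof (intro Bochner_Integration.integral_cong refl)
    fix t
    have "h x t = (exp (- (t * y)) *\<^sub>R \<phi> t) * (f (Complex x y) * exp (- \<i> * of_real t * Complex x y))" for x
    proof -
      have "exp (- \<i> * complex_of_real x * of_real t) = exp (of_real (- (t * y))) * exp (- \<i> * of_real t * Complex x y)"
        unfolding exp_add[symmetric] by (intro arg_cong[of _ _ exp]) (simp add: complex_eq_iff)
      also have "exp (of_real (- (t * y)) :: complex) = of_real (exp (- (t * y)))" by (rule exp_of_real)
      finally show ?thesis by (simp add: h_def scaleR_conv_of_real mult_ac)
    qed
    then have "(LINT x|lborel. h x t) = (exp (- (t * y)) *\<^sub>R \<phi> t) * (LINT x|lborel. f (Complex x y) * exp (- \<i> * of_real t * Complex x y))"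
      by simp
    then show "1 / sqrt (2 * pi) * (LINT x|lborel. h x t) = exp (- (t * y)) *\<^sub>R (spectrum t * \<phi> t)"
      unfolding spectrum_eq[OF y] by (simp add: scaleR_conv_of_real mult_ac)
  qed
  finally show "(LINT x|lborel. f (Complex x y) * fourier \<phi> x) = (LINT t|lborel. exp (- (t * y)) *\<^sub>R (spectrum t * \<phi> t))" .
qed

lemma integrable_spectrum_schwartz:
  "\<phi> \<in> schwartz \<Longrightarrow> integrable lborel (\<lambda>t. spectrum t * \<phi> t)"
  by (rule integrable_growth_mult_schwartz[OF _ measurable_spectrum norm_spectrum_le_poly])

text \<open>The damping factor tends to 1 and is at most 1 where the spectrum does not vanish,
so the limit is one of dominated convergence.\<close>
lemma boundary_values_pairing:
  assumes \<phi>: "\<phi> \<in> schwartz"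
  shows "((\<lambda>y. LINT x|lborel. f (Complex x y) * fourier \<phi> x) \<longlongrightarrow> pairing spectrum \<phi>) (at_right 0)"
proof -
  note int = integrable_spectrum_schwartz[OF \<phi>]
  note [measurable] = borel_measurable_integrable[OF int]
  have pair: "pairing spectrum \<phi> = (LINT t|lborel. spectrum t * \<phi> t)"
    unfolding pairing_def by (rule integral_completion) measurable
  have "((\<lambda>y. LINT t|lborel. exp (- (t * y)) *\<^sub>R (spectrum t * \<phi> t)) \<longlongrightarrow> (LINT t|lborel. spectrum t * \<phi> t)) (at_right 0)"
    unfolding tendsto_at_iff_sequentially comp_def
  proof (intro allI impI)
    fix Y :: "nat \<Rightarrow> real" assume Y: "\<forall>i. Y i \<in> {0<..} - {0}" "Y \<longlonglongrightarrow> 0"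
    show "(\<lambda>i. LINT t|lborel. exp (- (t * Y i)) *\<^sub>R (spectrum t * \<phi> t)) \<longlonglongrightarrow> (LINT t|lborel. spectrum t * \<phi> t)"
    proof (rule integral_dominated_convergence[where w = "\<lambda>t. norm (spectrum t * \<phi> t)"])
      show "integrable lborel (\<lambda>t. norm (spectrum t * \<phi> t))" using int by (rule integrable_norm)
      show "AE t in lborel. norm (exp (- (t * Y i)) *\<^sub>R (spectrum t * \<phi> t)) \<le> norm (spectrum t * \<phi> t)" for i
      proof (intro AE_I2)
        fix t
        show "norm (exp (- (t * Y i)) *\<^sub>R (spectrum t * \<phi> t)) \<le> norm (spectrum t * \<phi> t)"
        proof (cases "t < 0")
          case False
          then have "exp (- (t * Y i)) \<le> 1" using Y(1)[rule_format, of i] by simp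
          then show ?thesis using mult_right_mono[of _ 1 "norm (spectrum t * \<phi> t)"] by simp
        qed (simp add: spectrum_negative)
      qed
      show "AE t in lborel. (\<lambda>i. exp (- (t * Y i)) *\<^sub>R (spectrum t * \<phi> t)) \<longlonglongrightarrow> spectrum t * \<phi> t"
      proof (intro AE_I2)
        fix t
        have "(\<lambda>i. exp (- (t * Y i)) *\<^sub>R (spectrum t * \<phi> t)) \<longlonglongrightarrow> exp (- (t * 0)) *\<^sub>R (spectrum t * \<phi> t)"
          by (intro tendsto_intros Y)
        then show "(\<lambda>i. exp (- (t * Y i)) *\<^sub>R (spectrum t * \<phi> t)) \<longlonglongrightarrow> spectrum t * \<phi> t" by simp
      qed
    qed measurable
  qed
  then show ?thesis unfolding pair
  proof (rule Lim_transform_eventually)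
    show "\<forall>\<^sub>F y in at_right 0. (LINT t|lborel. exp (- (t * y)) *\<^sub>R (spectrum t * \<phi> t)) = (LINT x|lborel. f (Complex x y) * fourier \<phi> x)"
      using eventually_at_right_less[of 0]
      by eventually_elim (simp add: integrable_line_fourier(2)[OF \<phi>])
  qed
qed

end

section \<open>Hardy spaces\<close>

lemma hardy_norm_line_bound:
  assumes p: "0 < p" and f: "f \<in> hardy_space p" and y: "0 < y"
  shows "(\<integral>\<^sup>+x. ennreal (norm (f (Complex x y)) powr p) \<partial>lborel) \<le> ennreal (enn2real (hardy_norm p f) powr p)"
proof -
  define I where "I = (\<integral>\<^sup>+x. ennreal (norm (f (Complex x y)) powr p) \<partial>lborel)"
  have fin: "hardy_norm p f < \<infinity>" using f by (simp add: hardy_space_def)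
  have le: "ennreal_powr I (1 / p) \<le> hardy_norm p f"
    unfolding hardy_norm_def I_def by (rule SUP_upper) (use y in auto)
  with fin have I: "I \<noteq> \<infinity>" by (auto simp: ennreal_powr_def)
  have "ennreal (enn2real I powr (1 / p)) \<le> hardy_norm p f" using le I by (simp add: ennreal_powr_def)
  then have "enn2real I powr (1 / p) \<le> enn2real (hardy_norm p f)"
    using fin enn2real_mono by fastforce
  then have "(enn2real I powr (1 / p)) powr p \<le> enn2real (hardy_norm p f) powr p"
    using p by (intro powr_mono2) auto
  then have "enn2real I \<le> enn2real (hardy_norm p f) powr p"
    using p by (simp add: powr_powr)
  then have "ennreal (enn2real I) \<le> ennreal (enn2real (hardy_norm p f) powr p)" by (rule ennreal_leI)
  also have "ennreal (enn2real I) = I" using I by (simp add: less_top)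
  finally show ?thesis by (simp add: I_def)
qed

text \<open>The constant in the pointwise growth estimate below: four times the constant
\<open>8 * 4 powr (1 / p - 1)\<close> of the mean value inequality, the factor four coming from
the half-side \<open>y / 2\<close>.\<close>
definition growth_const :: "real \<Rightarrow> real" where
  "growth_const p = 32 * 4 powr (1 / p - 1)"

text \<open>The square of half-side \<open>y / 2\<close> about \<open>x + \<i> y\<close> lies in
the strip between heights \<open>y / 2\<close> and \<open>3 * y / 2\<close>, and each horizontal
line of that strip carries at most the \<open>p\<close>-th power of the Hardy norm.\<close>
lemma hardy_space_pointwise_bound:
  assumes p: "0 < p" "p \<le> 1" and f: "f \<in> hardy_space p" and y: "0 < y"
  shows "norm (f (Complex x y)) powr p \<le> growth_const p * enn2real (hardy_norm p f) powr p / y"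
proof -
  define M where "M = enn2real (hardy_norm p f) powr p"
  have M: "M \<ge> 0" by (simp add: M_def)
  have hol: "f holomorphic_on upper_half_plane" using f by (simp add: hardy_space_def)
  let ?z = "Complex x y" and ?c = "8 * 4 powr (1 / p - 1)"
  have sub: "csquare ?z (y / 2) \<subseteq> upper_half_plane"
  proof
    fix w assume "w \<in> csquare ?z (y / 2)"
    then have "\<bar>Im w - y\<bar> \<le> y / 2" by (simp add: csquare_iff)
    then show "w \<in> upper_half_plane" using y unfolding upper_half_plane_def mem_Collect_eq by linarith
  qed
  have "ennreal ((y / 2)\<^sup>2 * norm (f ?z) powr p)
      \<le> ennreal ?c * area_integral (\<lambda>w. ennreal (norm (f w) powr p) * indicator (csquare ?z (y / 2)) w)"
    using y by (intro powr_norm_le_square_mean[OF hol open_upper_half_plane convex_upper_half_plane sub _ p]) auto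
  also have "area_integral (\<lambda>w. ennreal (norm (f w) powr p) * indicator (csquare ?z (y / 2)) w)
      \<le> (\<integral>\<^sup>+v. ennreal M * indicator {y / 2..3 * y / 2} v \<partial>lborel)"
    unfolding area_integral_def
  proof (intro nn_integral_mono)
    fix v
    show "(\<integral>\<^sup>+u. ennreal (norm (f (Complex u v)) powr p) * indicator (csquare ?z (y / 2)) (Complex u v) \<partial>lborel)
        \<le> ennreal M * indicator {y / 2..3 * y / 2} v"
    proof (cases "v \<in> {y / 2..3 * y / 2}")
      case True
      then have "v > 0" using y by auto
      have "(\<integral>\<^sup>+u. ennreal (norm (f (Complex u v)) powr p) * indicator (csquare ?z (y / 2)) (Complex u v) \<partial>lborel)
         \<le> (\<integral>\<^sup>+u. ennreal (norm (f (Complex u v)) powr p) \<partial>lborel)"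
        by (intro nn_integral_mono) (auto simp: indicator_def)
      also have "\<dots> \<le> ennreal M"
        unfolding M_def by (rule hardy_norm_line_bound[OF p(1) f \<open>v > 0\<close>])
      finally show ?thesis using True by simp
    next
      case False
      have "\<not> \<bar>v - y\<bar> \<le> y / 2"
      proof
        assume "\<bar>v - y\<bar> \<le> y / 2"
        then have "y / 2 \<le> v" "v \<le> 3 * y / 2" by linarith+
        with False show "False" by simp
      qed
      then have "Complex u v \<notin> csquare ?z (y / 2)" for u by (simp add: csquare_iff)
      then show ?thesis by simp
    qed
  qed
  also have "\<dots> = ennreal (M * y)"
    using y M by (simp add: nn_integral_cmult_indicator ennreal_mult[symmetric] field_simps)
  finally have "ennreal ((y / 2)\<^sup>2 * norm (f ?z) powr p) \<le> ennreal (?c * (M * y))"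
    using M y by (simp add: ennreal_mult[symmetric] mult_left_mono)
  then have "(y / 2)\<^sup>2 * norm (f ?z) powr p \<le> ?c * (M * y)"
    using M y by (subst (asm) ennreal_le_iff) auto
  then have "y * (y * norm (f ?z) powr p) \<le> y * (growth_const p * M)"
    by (simp add: growth_const_def power2_eq_square field_simps)
  then have "y * norm (f ?z) powr p \<le> growth_const p * M" using y by simp
  then show ?thesis using y by (simp add: M_def pos_le_divide_eq mult.commute)
qed

text \<open>Splitting \<open>norm (f w)\<close> into its powers with exponents \<open>p\<close>
and \<open>1 - p\<close>, the first is integrated along the line and the second is estimated
pointwise. The powers \<open>p\<close> and \<open>1 - p\<close> of the Hardy norm recombine to
the norm itself, so the resulting bound is linear in it.\<close>
lemma hardy_space_integrable_on_lines:
  assumes p: "0 < p" "p \<le> 1" and f: "f \<in> hardy_space p"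
  shows "integrable_on_lines f (growth_const p powr (1 / p - 1) * enn2real (hardy_norm p f)) (1 / p - 1)"
proof
  define M where "M = enn2real (hardy_norm p f)"
  define \<alpha> where "\<alpha> = 1 / p - 1"
  have M: "M \<ge> 0" and k: "growth_const p > 0" by (auto simp: M_def growth_const_def)
  show \<alpha>: "0 \<le> 1 / p - 1" using p by (simp add: field_simps)
  show "f holomorphic_on upper_half_plane" using f by (simp add: hardy_space_def)
  show "0 \<le> growth_const p powr (1 / p - 1) * enn2real (hardy_norm p f)" by simp
  fix y :: real assume y: "0 < y"
  let ?L = "growth_const p powr \<alpha> * M powr (1 - p) * y powr - \<alpha>"
  have p\<alpha>: "p * \<alpha> = 1 - p" using p by (simp add: \<alpha>_def field_simps)
  have pt: "norm (f (Complex x y)) \<le> ?L * norm (f (Complex x y)) powr p" for x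
  proof -
    have "(norm (f (Complex x y)) powr p) powr \<alpha> \<le> (growth_const p * M powr p / y) powr \<alpha>"
      using hardy_space_pointwise_bound[OF p f y, of x] \<alpha> by (intro powr_mono2) (auto simp: M_def \<alpha>_def)
    then have "norm (f (Complex x y)) powr (1 - p) \<le> ?L"
      using k y by (simp add: powr_powr powr_mult powr_divide powr_minus_divide p\<alpha>)
    then have "norm (f (Complex x y)) powr p * norm (f (Complex x y)) powr (1 - p) \<le> norm (f (Complex x y)) powr p * ?L"
      by (intro mult_left_mono) auto
    then show ?thesis by (simp add: powr_split mult.commute)
  qed
  have [measurable]: "(\<lambda>x. f (Complex x y)) \<in> borel_measurable borel"
    using f y by (intro measurable_horizontal_line) (auto simp: hardy_space_def)
  have "(\<integral>\<^sup>+x. ennreal (norm (f (Complex x y))) \<partial>lborel) \<le> (\<integral>\<^sup>+x. ennreal ?L * ennreal (norm (f (Complex x y)) powr p) \<partial>lborel)"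
    by (intro nn_integral_mono) (use pt in \<open>auto simp: ennreal_mult[symmetric] intro!: ennreal_leI\<close>)
  also have "\<dots> = ennreal ?L * (\<integral>\<^sup>+x. ennreal (norm (f (Complex x y)) powr p) \<partial>lborel)"
    by (intro nn_integral_cmult) measurable
  also have "\<dots> \<le> ennreal ?L * ennreal (M powr p)"
    unfolding M_def by (intro mult_left_mono hardy_norm_line_bound[OF p(1) f y]) auto
  also have "\<dots> = ennreal (growth_const p powr \<alpha> * (M powr p * M powr (1 - p)) * y powr - \<alpha>)"
    by (subst ennreal_mult[symmetric]) (auto simp: mult_ac)
  also have "\<dots> = ennreal (growth_const p powr (1 / p - 1) * enn2real (hardy_norm p f) * y powr - (1 / p - 1))"
    unfolding powr_split[OF M] by (simp add: M_def \<alpha>_def)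
  finally show "(\<integral>\<^sup>+x. ennreal (norm (f (Complex x y))) \<partial>lborel)
     \<le> ennreal (growth_const p powr (1 / p - 1) * enn2real (hardy_norm p f) * y powr - (1 / p - 1))" .
qed

theorem theorem3:
  fixes p :: real
  assumes "0 < p" and "p \<le> 1"
  shows "\<exists>A::real. A > 0 \<and>
    (\<forall>f \<in> hardy_space p. \<exists>F :: real \<Rightarrow> complex.
       slowly_increasing F \<and> continuous_on UNIV F \<and> closure {t. F t \<noteq> 0} \<subseteq> {0..} \<and>
       (\<forall>\<phi> \<in> schwartz.
          integrable lebesgue (\<lambda>x. F x * \<phi> x) \<and>
          (\<forall>y>0. integrable lborel (\<lambda>x. f (Complex x y) * fourier \<phi> x)) \<and>
          ((\<lambda>y. LINT x|lborel. f (Complex x y) * fourier \<phi> x) \<longlongrightarrow> pairing F \<phi>) (at_right 0)) \<and>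
       (\<forall>t. cmod (F t) \<le> A * enn2real (hardy_norm p f) * hardy_weight p t) \<and>
       (\<forall>z \<in> upper_half_plane.
          set_integrable lborel {0..} (\<lambda>t. F t * exp (\<i> * of_real t * z)) \<and>
          f z = 1 / sqrt (2 * pi) * (LINT t:{0..}|lborel. F t * exp (\<i> * of_real t * z))))"
proof (intro exI conjI ballI)
  let ?K = "growth_const p powr (1 / p - 1)"
  show "0 < exp 1 * ?K" by (simp add: growth_const_def)
  fix f assume f: "f \<in> hardy_space p"
  define M where "M = enn2real (hardy_norm p f)"
  interpret integrable_on_lines f "?K * M" "1 / p - 1"
    unfolding M_def by (rule hardy_space_integrable_on_lines[OF assms f])
  show "slowly_increasing spectrum" by (rule slowly_increasing_spectrum)
  show "continuous_on UNIV spectrum" by (rule continuous_spectrum)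
  show "closure {t. spectrum t \<noteq> 0} \<subseteq> {0..}"
    by (intro closure_minimal) (use spectrum_negative in \<open>auto simp: not_less[symmetric]\<close>)
  show "\<forall>t. norm (spectrum t) \<le> exp 1 * ?K * enn2real (hardy_norm p f) * hardy_weight p t"
  proof
    fix t
    have w: "0 \<le> hardy_weight p t" by (simp add: hardy_weight_def)
    have C: "0 \<le> ?K * M" by (rule C_nonneg)
    consider "t < 0" | "t = 0" | "t > 0" by linarith
    then have "norm (spectrum t) \<le> exp 1 * (?K * M) * hardy_weight p t"
    proof cases
      case 1
      then show ?thesis using spectrum_negative[of t] w C by simp
    next
      case 2
      then show ?thesis
        using norm_spectrum_0 assms mult_right_mono[of 1 "exp 1" "?K * M"] C
        by (auto simp: hardy_weight_def split: if_splits)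
    next
      case 3
      then show ?thesis using norm_spectrum_le_powr[OF 3] by (auto simp: hardy_weight_def)
    qed
    then show "norm (spectrum t) \<le> exp 1 * ?K * enn2real (hardy_norm p f) * hardy_weight p t"
      by (simp add: M_def mult.assoc)
  qed
  fix \<phi> assume \<phi>: "\<phi> \<in> schwartz"
  show "integrable lebesgue (\<lambda>x. spectrum x * \<phi> x)"
    using integrable_spectrum_schwartz[OF \<phi>] by (simp add: integrable_completion borel_measurable_integrable)
  show "\<forall>y>0. integrable lborel (\<lambda>x. f (Complex x y) * fourier \<phi> x)"
    using integrable_line_fourier(1)[OF \<phi>] by blast
  show "((\<lambda>y. LINT x|lborel. f (Complex x y) * fourier \<phi> x) \<longlongrightarrow> pairing spectrum \<phi>) (at_right 0)"
    by (rule boundary_values_pairing[OF \<phi>])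
next
  fix f z assume f: "f \<in> hardy_space p" and z: "z \<in> upper_half_plane"
  interpret integrable_on_lines f "growth_const p powr (1 / p - 1) * enn2real (hardy_norm p f)" "1 / p - 1"
    by (rule hardy_space_integrable_on_lines[OF assms f])
  show "set_integrable lborel {0..} (\<lambda>t. spectrum t * exp (\<i> * of_real t * z))"
    "f z = 1 / sqrt (2 * pi) * (LINT t:{0..}|lborel. spectrum t * exp (\<i> * of_real t * z))"
    by (rule spectrum_inversion[OF z])+
qed

end
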